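(* Fix $\alpha\in(0,1)$ and $d\ge 1$. Let $v:\mathbb{R}^d\times(0,\tau)\to\mathbb{R}^d$ satisfy the standing assumption below, and let $\phi^\tau$ be the time-$\tau$ flow map of $\dot x(t)=v(x(t),t)$, $t\in(0,\tau)$, $x(0)=x_0\in\mathbb{R}^d$. Let $\Omega\subset\mathbb{R}^d$ be compact. Then for every $\varepsilon>0$ and $\tau>0$ there exist $L\in\mathbb{N}$ and a leaky-ReLU network $f_L\in\mathcal{N}_d(L)$ (width $d$, depth $L$) such that $\|f_L(x)-\phi^\tau(x)\|\le\varepsilon$ for all $x\in\Omega$.
   Context: Leaky-ReLU: for $\alpha\in(0,1)$, $\sigma_\alpha(x)=\max(\alpha x,x)$, applied componentwise to vectors. The class $\mathcal{N}_d(L)$ of leaky-ReLU networks of width $d$ and depth $L$ consists of all maps $f_L:\mathbb{R}^d\to\mathbb{R}^d$ defined recursively by $f_0(x)=W^{[0]}x+b^{[0]}$, $f_k(x)=W^{[k]}\sigma_\alpha(f_{k-1}(x))+b^{[k]}$ for $k=1,\dots,L$, with arbitrary $W^{[k]}\in\mathbb{R}^{d\times d}$, $b^{[k]}\in\mathbb{R}^d$. Standing assumption on $v$: $v(x,t)$ is Lipschitz continuous in $x\in\mathbb{R}^d$ and piecewise smooth in $t\in(0,\tau)$, and on each piece $v$ is continuous in $(x,t)$. The flow map $\phi^\tau$ sends $x_0$ to $x(\tau)$. *)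

theory Defs
  imports "HOL-Analysis.Analysis"
begin

definition leaky_relu :: "real \<Rightarrow> real ^ 'n \<Rightarrow> real ^ 'n" where
  "leaky_relu \<alpha> x = (\<chi> i. max (\<alpha> * x $ i) (x $ i))"

fun net_eval :: "real \<Rightarrow> (nat \<Rightarrow> real ^ 'n ^ 'n) \<Rightarrow> (nat \<Rightarrow> real ^ 'n) \<Rightarrow> nat \<Rightarrow> real ^ 'n \<Rightarrow> real ^ 'n" where
  "net_eval \<alpha> W b 0 x = W 0 *v x + b 0"
| "net_eval \<alpha> W b (Suc k) x = W (Suc k) *v leaky_relu \<alpha> (net_eval \<alpha> W b k x) + b (Suc k)"

definition leaky_nets :: "real \<Rightarrow> nat \<Rightarrow> (real ^ 'n \<Rightarrow> real ^ 'n) set" where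
  "leaky_nets \<alpha> L = {f. \<exists>W b. f = net_eval \<alpha> W b L}"

definition smooth_on :: "(real \<Rightarrow> 'a::real_normed_vector) \<Rightarrow> real set \<Rightarrow> bool" where
  "smooth_on f S \<longleftrightarrow> (\<exists>D :: nat \<Rightarrow> real \<Rightarrow> 'a. (\<forall>t\<in>S. D 0 t = f t) \<and>
      (\<forall>k. \<forall>t\<in>S. (D k has_vector_derivative D (Suc k) t) (at t within S)))"

definition standing_assumption :: "(real ^ 'n \<Rightarrow> real \<Rightarrow> real ^ 'n) \<Rightarrow> real \<Rightarrow> bool" where
  "standing_assumption v \<tau> \<longleftrightarrow>
     (\<exists>K. \<forall>t\<in>{0<..<\<tau>}. K-lipschitz_on UNIV (\<lambda>x. v x t)) \<and>
     (\<exists>m::nat. \<exists>s :: nat \<Rightarrow> real. s 0 = 0 \<and> s m = \<tau> \<and> (\<forall>i<m. s i < s (Suc i)) \<and>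
        (\<forall>i<m. continuous_on (UNIV \<times> {s i<..<s (Suc i)}) (\<lambda>(x, t). v x t) \<and>
               (\<forall>x. smooth_on (\<lambda>t. v x t) {s i<..<s (Suc i)})))"

text \<open>(Caratheodory) solution of x' = v(x,t) on [0,tau], x(0) = x0, in integral form.\<close>
definition ode_solution :: "(real ^ 'n \<Rightarrow> real \<Rightarrow> real ^ 'n) \<Rightarrow> real \<Rightarrow> real ^ 'n \<Rightarrow> (real \<Rightarrow> real ^ 'n) \<Rightarrow> bool" where
  "ode_solution v \<tau> x0 X \<longleftrightarrow> continuous_on {0..\<tau>} X \<and> X 0 = x0 \<and>
     (\<forall>t\<in>{0..\<tau>}. ((\<lambda>s. v (X s) s) has_integral (X t - x0)) {0..t})"

definition flow_map :: "(real ^ 'n \<Rightarrow> real \<Rightarrow> real ^ 'n) \<Rightarrow> real \<Rightarrow> real ^ 'n \<Rightarrow> real ^ 'n" where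
  "flow_map v \<tau> x0 = (THE y. \<exists>X. ode_solution v \<tau> x0 X \<and> X \<tau> = y)"

end

theory Submission
  imports Defs
begin

text \<open>Locally uniform limits of leaky-ReLU networks of width \<open>d\<close> form a monoid under composition.
  It contains the affine maps and the leaky ReLU of a single coordinate, hence every change of one
  coordinate by a function with slopes in \<open>[\<alpha>, 1 / \<alpha>]\<close>, and, after a linear change of coordinates,
  the maps \<open>x + h a cos (w \<bullet> x + b) e\<^sub>j\<close> for small \<open>h\<close>: one Euler step of a ridge field.
  Sums of ridge fields are dense by Stone--Weierstrass, and Lie splitting handles the sums.
  So the solutions of an ODE can be followed over short time intervals with an error
  that composes; Bolzano's bisection argument extends this to closed subintervals of the continuity
  pieces, and near a breakpoint the identity is good enough.
  As \<open>v\<close> need not be absolutely integrable at the breakpoints, everything is done for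
  \<open>y \<mapsto> v (Z t + y) t - v (Z t) t\<close> along one solution \<open>Z\<close>, which grows at most linearly in \<open>y\<close>.\<close>

subsection \<open>Locally uniform limits of leaky-ReLU networks\<close>

text \<open>With width \<open>d\<close> there is no spare neuron: a layer cannot keep its input
  beside a correction, so a field has to be realised by composing maps close to the identity. The
  one-coordinate maps available for this are increasing with slopes bounded away from 0, and small
  Euler steps fit that restriction: y + c cos (y + b) has slopes within |c| of 1. Cosines serve two
  purposes. A product of cosines is again a sum of cosines, so their sums form an algebra; and the
  Euler step of a single ridge field is conjugate to a one-dimensional map, hence realised without
  discretisation error. Splitting a sum then costs O(h^2), which is negligible against h. Bisection
  yields no bound on the number of steps, so the errors cannot be summed by counting them; the
  tolerance is instead a function of time that every step respects. At a breakpoint \<open>v\<close>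
  may oscillate or blow up, while its Lipschitz constant in \<open>x\<close> stays uniform in time.
  Only differences of \<open>v\<close> at two points are therefore under control.\<close>

definition net_approximable :: "real \<Rightarrow> (real ^ 'n \<Rightarrow> real ^ 'n) \<Rightarrow> bool" where
  "net_approximable \<alpha> F \<longleftrightarrow> continuous_on UNIV F \<and>
     (\<forall>B. \<forall>\<epsilon>>0. \<exists>L. \<exists>f\<in>leaky_nets \<alpha> L. \<forall>x. norm x \<le> B \<longrightarrow> norm (f x - F x) \<le> \<epsilon>)"

lemma net_eval_cong:
  assumes "\<And>k. k \<le> L \<Longrightarrow> W k = W' k" "\<And>k. k \<le> L \<Longrightarrow> b k = b' k"
  shows "net_eval \<alpha> W b L = net_eval \<alpha> W' b' L"
  using assms by (induction L) (auto simp: fun_eq_iff)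

text \<open>The output layer is itself affine and absorbs the map, so the depth is
  unchanged.\<close>

lemma leaky_nets_affine:
  fixes A :: "real ^ 'n ^ 'n"
  assumes "f \<in> leaky_nets \<alpha> L"
  shows "(\<lambda>x. A *v f x + c) \<in> leaky_nets \<alpha> L"
proof -
  obtain W b where f: "f = net_eval \<alpha> W b L"
    using assms by (auto simp: leaky_nets_def)
  have "(\<lambda>x. A *v f x + c) = net_eval \<alpha> (W(L := A ** W L)) (b(L := A *v b L + c)) L"
  proof (cases L)
    case 0
    then show ?thesis
      by (simp add: f fun_eq_iff matrix_vector_right_distrib matrix_vector_mul_assoc)
  next
    case (Suc k)
    have "net_eval \<alpha> (W(L := A ** W L)) (b(L := A *v b L + c)) k = net_eval \<alpha> W b k"
      by (rule net_eval_cong) (auto simp: Suc)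
    then show ?thesis
      by (simp add: f Suc fun_eq_iff matrix_vector_right_distrib matrix_vector_mul_assoc)
  qed
  then show ?thesis by (auto simp: leaky_nets_def)
qed

lemma leaky_nets_leaky_relu:
  fixes A :: "real ^ 'n ^ 'n"
  assumes "f \<in> leaky_nets \<alpha> L"
  shows "(\<lambda>x. A *v leaky_relu \<alpha> (f x) + c) \<in> leaky_nets \<alpha> (Suc L)"
proof -
  obtain W b where f: "f = net_eval \<alpha> W b L"
    using assms by (auto simp: leaky_nets_def)
  have "net_eval \<alpha> (W(Suc L := A)) (b(Suc L := c)) L = net_eval \<alpha> W b L"
    by (rule net_eval_cong) auto
  then have "(\<lambda>x. A *v leaky_relu \<alpha> (f x) + c)
      = net_eval \<alpha> (W(Suc L := A)) (b(Suc L := c)) (Suc L)"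
    by (simp add: f fun_eq_iff)
  then show ?thesis by (auto simp: leaky_nets_def)
qed

text \<open>The affine input layer of \<open>g\<close> merges with the output layer of
  \<open>f\<close>; every further layer of \<open>g\<close> is appended unchanged.\<close>

lemma leaky_nets_comp:
  fixes f g :: "real ^ 'n \<Rightarrow> real ^ 'n"
  assumes "g \<in> leaky_nets \<alpha> L" "f \<in> leaky_nets \<alpha> M"
  shows "\<exists>N. g \<circ> f \<in> leaky_nets \<alpha> N"
proof -
  obtain W b where g: "g = net_eval \<alpha> W b L"
    using assms by (auto simp: leaky_nets_def)
  have "\<exists>N. (\<lambda>x. net_eval \<alpha> W b L (f x)) \<in> leaky_nets \<alpha> N"
  proof (induction L)
    case 0
    show ?case using leaky_nets_affine[OF assms(2), of "W 0" "b 0"] by auto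
  next
    case (Suc k)
    then show ?case
      using leaky_nets_leaky_relu[of "\<lambda>x. net_eval \<alpha> W b k (f x)" \<alpha> _ "W (Suc k)" "b (Suc k)"]
      by auto
  qed
  then show ?thesis by (simp add: g o_def)
qed

lemma affine_in_leaky_nets: "(\<lambda>x. A *v x + c) \<in> leaky_nets \<alpha> 0"
  by (force simp: leaky_nets_def fun_eq_iff)

lemma net_approximableI:
  assumes "continuous_on UNIV F"
    and "\<And>B \<epsilon>. 0 < \<epsilon> \<Longrightarrow> \<exists>L. \<exists>f\<in>leaky_nets \<alpha> L. \<forall>x. norm x \<le> B \<longrightarrow> norm (f x - F x) \<le> \<epsilon>"
  shows "net_approximable \<alpha> F"
  using assms by (auto simp: net_approximable_def)

lemma net_approximable_limit:
  assumes "continuous_on UNIV F"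
    and "\<And>B \<epsilon>. 0 < \<epsilon> \<Longrightarrow> \<exists>G. net_approximable \<alpha> G \<and> (\<forall>x. norm x \<le> B \<longrightarrow> norm (G x - F x) \<le> \<epsilon>)"
  shows "net_approximable \<alpha> F"
proof (rule net_approximableI[OF assms(1)])
  fix B \<epsilon> :: real assume "0 < \<epsilon>"
  obtain G where G: "net_approximable \<alpha> G" "\<And>x. norm x \<le> B \<Longrightarrow> norm (G x - F x) \<le> \<epsilon>/2"
    using assms(2)[of "\<epsilon>/2" B] \<open>0 < \<epsilon>\<close> by auto
  obtain L f where f: "f \<in> leaky_nets \<alpha> L" "\<And>x. norm x \<le> B \<Longrightarrow> norm (f x - G x) \<le> \<epsilon>/2"
    using G(1) \<open>0 < \<epsilon>\<close> unfolding net_approximable_def by (meson half_gt_zero)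
  have "norm (f x - F x) \<le> \<epsilon>" if "norm x \<le> B" for x
    using norm_triangle_le[of "f x - G x" "G x - F x" \<epsilon>] f(2)[OF that] G(2)[OF that] by simp
  with f(1) show "\<exists>L. \<exists>f\<in>leaky_nets \<alpha> L. \<forall>x. norm x \<le> B \<longrightarrow> norm (f x - F x) \<le> \<epsilon>" by blast
qed

lemma net_approximable_comp:
  fixes F G :: "real ^ 'n \<Rightarrow> real ^ 'n"
  assumes G: "net_approximable \<alpha> G" and F: "net_approximable \<alpha> F"
  shows "net_approximable \<alpha> (G \<circ> F)"
proof (rule net_approximableI)
  show "continuous_on UNIV (G \<circ> F)"
    using assms by (metis continuous_on_compose continuous_on_subset net_approximable_def subset_UNIV)
  fix B \<epsilon> :: real assume "0 < \<epsilon>"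
  have "compact (F ` cball 0 B)"
    using F by (intro compact_continuous_image)
      (auto simp: net_approximable_def intro: continuous_on_subset)
  then obtain B' where B': "\<And>x. norm x \<le> B \<Longrightarrow> norm (F x) \<le> B'"
    by (metis bounded_iff compact_imp_bounded image_eqI mem_cball_0)
  have "uniformly_continuous_on (cball 0 (B' + 1)) G"
    using G by (intro compact_uniformly_continuous)
      (auto simp: net_approximable_def intro: continuous_on_subset)
  then obtain d where d: "d > 0"
    "\<And>x y. norm x \<le> B' + 1 \<Longrightarrow> norm y \<le> B' + 1 \<Longrightarrow> dist y x < d \<Longrightarrow> dist (G y) (G x) < \<epsilon>/2"
    unfolding uniformly_continuous_on_def using \<open>0 < \<epsilon>\<close> by (metis half_gt_zero mem_cball_0)
  \<comment> \<open>The bound 1 keeps \<open>f x\<close> in the ball of radius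
    \<open>B' + 1\<close>, where \<open>g\<close> is close to \<open>G\<close>; the bound
    \<open>d/2\<close> serves the uniform continuity of \<open>G\<close>.\<close>
  define e where "e = min 1 (d/2)"
  have e: "0 < e" "e \<le> 1" "e < d" using d(1) by (auto simp: e_def)
  obtain L f where f: "f \<in> leaky_nets \<alpha> L" "\<And>x. norm x \<le> B \<Longrightarrow> norm (f x - F x) \<le> e"
    using F e(1) unfolding net_approximable_def by meson
  obtain M g where g: "g \<in> leaky_nets \<alpha> M" "\<And>x. norm x \<le> B' + 1 \<Longrightarrow> norm (g x - G x) \<le> \<epsilon>/2"
    using G \<open>0 < \<epsilon>\<close> unfolding net_approximable_def by (meson half_gt_zero)
  have "norm ((g \<circ> f) x - (G \<circ> F) x) \<le> \<epsilon>" if x: "norm x \<le> B" for x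
  proof -
    have fx: "norm (f x) \<le> B' + 1"
      using norm_triangle_ineq[of "f x - F x" "F x"] f(2)[OF x] B'[OF x] e(2) by simp
    have "dist (G (f x)) (G (F x)) < \<epsilon>/2"
      using f(2)[OF x] B'[OF x] e by (intro d(2) fx) (auto simp: dist_norm)
    then show ?thesis
      using g(2)[OF fx] norm_triangle_le[of "g (f x) - G (f x)" "G (f x) - G (F x)" \<epsilon>]
      by (simp add: dist_norm)
  qed
  then show "\<exists>L. \<exists>f\<in>leaky_nets \<alpha> L. \<forall>x. norm x \<le> B \<longrightarrow> norm (f x - (G \<circ> F) x) \<le> \<epsilon>"
    using leaky_nets_comp[OF g(1) f(1)] by blast
qed

lemma net_approximable_affine:
  fixes A :: "real ^ 'n \<Rightarrow> real ^ 'n"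
  assumes "linear A"
  shows "net_approximable \<alpha> (\<lambda>x. A x + c)"
proof (rule net_approximableI)
  show "continuous_on UNIV (\<lambda>x. A x + c)"
    using assms by (intro continuous_intros linear_continuous_on linear_conv_bounded_linear[THEN iffD1])
  show "\<exists>L. \<exists>f\<in>leaky_nets \<alpha> L. \<forall>x. norm x \<le> B \<longrightarrow> norm (f x - (A x + c)) \<le> \<epsilon>"
    if "0 < \<epsilon>" for B \<epsilon> :: real
    using affine_in_leaky_nets[of "matrix A" c \<alpha>] that
    by (intro exI bexI) (auto simp: fun_cong[OF matrix_vector_mul(2)[OF assms]])
qed

lemma net_approximable_translation: "net_approximable \<alpha> (\<lambda>x :: real ^ 'n. x + c)"
  by (intro net_approximable_affine) (simp add: linear_id[unfolded id_def])

lemma net_approximable_ident: "net_approximable \<alpha> (\<lambda>x :: real ^ 'n. x)"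
  using net_approximable_translation[of \<alpha> 0] by simp

section \<open>Maps that change a single coordinate\<close>

definition coord_update :: "'n \<Rightarrow> (real \<Rightarrow> real) \<Rightarrow> real ^ 'n \<Rightarrow> real ^ 'n" where
  "coord_update j f x = x + (f (x $ j) - x $ j) *\<^sub>R axis j 1"

lemma coord_update_comp: "coord_update j g \<circ> coord_update j f = coord_update j (g \<circ> f)"
  by (auto simp: coord_update_def fun_eq_iff algebra_simps)

lemma continuous_on_coord_update:
  assumes "continuous_on UNIV f"
  shows "continuous_on UNIV (coord_update j f)"
  unfolding coord_update_def
  by (intro continuous_intros continuous_on_compose2[OF assms]) auto

lemma net_approximable_coord_affine:
  fixes j :: "'n::finite"
  shows "net_approximable \<alpha> (coord_update j (\<lambda>y. p * y + q))"
proof -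
  have "linear (\<lambda>x :: real ^ 'n. x + (p * x $ j - x $ j) *\<^sub>R axis j 1)"
    by (rule linearI) (auto simp: algebra_simps)
  from net_approximable_affine[OF this, of \<alpha> "q *\<^sub>R axis j 1"]
  show ?thesis by (simp add: coord_update_def[abs_def] algebra_simps)
qed

lemma net_approximable_coord_leaky:
  fixes j :: "'n::finite"
  assumes "0 < \<alpha>" "\<alpha> < 1"
  shows "net_approximable \<alpha> (coord_update j (\<lambda>y. max (\<alpha> * y) y))"
proof (rule net_approximableI)
  show "continuous_on UNIV (coord_update j (\<lambda>y. max (\<alpha> * y) y))"
    by (intro continuous_on_coord_update continuous_intros)
  fix B \<epsilon> :: real assume "0 < \<epsilon>"
  \<comment> \<open>On the bounded set, a large shift keeps the other coordinates in the linear region.\<close>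
  define b :: "real ^ 'n" where "b = (\<chi> i. if i = j then 0 else \<bar>B\<bar>)"
  define f where "f = (\<lambda>x. mat 1 *v leaky_relu \<alpha> (mat 1 *v x + b) + - b)"
  have "f \<in> leaky_nets \<alpha> (Suc 0)"
    unfolding f_def by (intro leaky_nets_leaky_relu affine_in_leaky_nets)
  moreover have "f x = coord_update j (\<lambda>y. max (\<alpha> * y) y) x" if "norm x \<le> B" for x
  proof -
    have *: "\<alpha> * (x $ i + \<bar>B\<bar>) \<le> x $ i + \<bar>B\<bar>" for i
      using component_le_norm_cart[of x i] that assms by (intro mult_left_le_one_le) auto
    show ?thesis
      using * by (auto simp: f_def coord_update_def leaky_relu_def b_def vec_eq_iff axis_def max_def)
  qed
  ultimately show "\<exists>L. \<exists>f\<in>leaky_nets \<alpha> L. \<forall>x. norm x \<le> B \<longrightarrow>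
      norm (f x - coord_update j (\<lambda>y. max (\<alpha> * y) y) x) \<le> \<epsilon>"
    using \<open>0 < \<epsilon>\<close> by (intro exI[of _ "Suc 0"] bexI[of _ f]) auto
qed

lemma net_approximable_coord_limit:
  fixes j :: "'n::finite"
  assumes "continuous_on UNIV F"
    and "\<And>B \<epsilon>. 0 < \<epsilon> \<Longrightarrow> \<exists>g. net_approximable \<alpha> (coord_update j g) \<and> (\<forall>y. \<bar>y\<bar> \<le> B \<longrightarrow> \<bar>g y - F y\<bar> \<le> \<epsilon>)"
  shows "net_approximable \<alpha> (coord_update j F)"
proof (rule net_approximable_limit[OF continuous_on_coord_update[OF assms(1)]])
  fix B \<epsilon> :: real assume "0 < \<epsilon>"
  then obtain g where g: "net_approximable \<alpha> (coord_update j g)" "\<And>y. \<bar>y\<bar> \<le> B \<Longrightarrow> \<bar>g y - F y\<bar> \<le> \<epsilon>"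
    using assms(2)[of \<epsilon> B] by auto
  have "norm (coord_update j g x - coord_update j F x) \<le> \<epsilon>" if "norm x \<le> B" for x
  proof -
    have "coord_update j g x - coord_update j F x = (g (x $ j) - F (x $ j)) *\<^sub>R axis j 1"
      by (simp add: coord_update_def algebra_simps)
    moreover have "\<bar>x $ j\<bar> \<le> B"
      using component_le_norm_cart[of x j] that by simp
    ultimately show ?thesis using g(2)[of "x $ j"] by simp
  qed
  with g(1) show "\<exists>G. net_approximable \<alpha> G \<and>
      (\<forall>x. norm x \<le> B \<longrightarrow> norm (G x - coord_update j F x) \<le> \<epsilon>)" by blast
qed

text \<open>A leaky ReLU moved to \<open>c\<close> and normalised to be the identity on the left.
  Composed after a monotone function, it leaves everything already built below the value
  \<open>c\<close> untouched.\<close>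

definition kink :: "real \<Rightarrow> real \<Rightarrow> real \<Rightarrow> real" where
  "kink c \<beta> y = (if y \<le> c then y else c + \<beta> * (y - c))"

lemma net_approximable_coord_comp:
  fixes j :: "'n::finite"
  assumes "net_approximable \<alpha> (coord_update j g)" "net_approximable \<alpha> (coord_update j f)"
  shows "net_approximable \<alpha> (coord_update j (g \<circ> f))"
  using net_approximable_comp[OF assms] by (simp add: coord_update_comp)

lemma leaky_eq:
  fixes \<alpha> y :: real
  assumes "0 < \<alpha>" "\<alpha> < 1"
  shows "max (\<alpha> * y) y = (if 0 \<le> y then y else \<alpha> * y)"
proof (cases "0 \<le> y")
  case True
  then have "\<alpha> * y \<le> y" using assms by (intro mult_left_le_one_le) auto
  then show ?thesis using True by simp
next
  case False
  then have "1 * y \<le> \<alpha> * y" using assms by (intro mult_right_mono_neg) auto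
  then show ?thesis using False by simp
qed

text \<open>Reflecting at \<open>c\<close> before and after the leaky ReLU moves its slope \<alpha>
  to the right side. Rescaling its output by 1/\<alpha> instead turns the slopes \<alpha>, 1 into 1,
  1/\<alpha>.\<close>

lemma net_approximable_kink:
  fixes j :: "'n::finite"
  assumes "0 < \<alpha>" "\<alpha> < 1" "\<beta> \<in> {\<alpha>, 1 / \<alpha>}"
  shows "net_approximable \<alpha> (coord_update j (kink c \<beta>))"
proof (cases "\<beta> = \<alpha>")
  case True
  have "kink c \<beta> = (\<lambda>y. -1 * y + c) \<circ> (\<lambda>y. max (\<alpha> * y) y) \<circ> (\<lambda>y. -1 * y + c)"
  proof
    fix y
    show "kink c \<beta> y = ((\<lambda>y. -1 * y + c) \<circ> (\<lambda>y. max (\<alpha> * y) y) \<circ> (\<lambda>y. -1 * y + c)) y"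
      using leaky_eq[OF assms(1,2), of "c - y"] True
      by (auto simp: kink_def algebra_simps)
  qed
  then show ?thesis
    by (simp only:) (intro net_approximable_coord_comp net_approximable_coord_affine
        net_approximable_coord_leaky assms)
next
  case False
  then have \<beta>: "\<beta> = 1 / \<alpha>" using assms by auto
  have "kink c \<beta> = (\<lambda>y. 1 / \<alpha> * y + c) \<circ> (\<lambda>y. max (\<alpha> * y) y) \<circ> (\<lambda>y. 1 * y + - c)"
  proof
    fix y
    show "kink c \<beta> y = ((\<lambda>y. 1 / \<alpha> * y + c) \<circ> (\<lambda>y. max (\<alpha> * y) y) \<circ> (\<lambda>y. 1 * y + - c)) y"
      unfolding o_def leaky_eq[OF assms(1,2)] kink_def \<beta>
      using assms(1) by (auto simp: field_simps)
  qed
  then show ?thesis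
    by (simp only:) (intro net_approximable_coord_comp net_approximable_coord_affine
        net_approximable_coord_leaky assms)
qed

subsection \<open>Monotone functions of one coordinate\<close>

lemma mono_kink:
  assumes "0 \<le> \<beta>"
  shows "mono (kink c \<beta>)"
proof (rule monoI)
  fix x y :: real assume "x \<le> y"
  show "kink c \<beta> x \<le> kink c \<beta> y"
  proof (cases "x \<le> c \<and> \<not> y \<le> c")
    case True
    then have "0 \<le> \<beta> * (y - c)" using assms by (intro mult_nonneg_nonneg) auto
    then show ?thesis using True by (simp add: kink_def)
  next
    case False
    then show ?thesis using assms \<open>x \<le> y\<close> by (auto simp: kink_def mult_left_mono)
  qed
qed

text \<open>A greedy control: on each grid cell take the slope \<open>\<alpha>\<close> if the current value is above the
  target and \<open>1 / \<alpha>\<close> if it is below.\<close>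
lemma greedy_coord_approximation:
  fixes j :: "'n::finite" and F :: "real \<Rightarrow> real"
  assumes \<alpha>: "0 < \<alpha>" "\<alpha> < 1" and \<eta>: "0 < \<eta>"
    and F: "\<And>x y. x \<le> y \<Longrightarrow> \<alpha> * (y - x) \<le> F y - F x"
      "\<And>x y. x \<le> y \<Longrightarrow> F y - F x \<le> (y - x) / \<alpha>"
  shows "\<exists>g. net_approximable \<alpha> (coord_update j g) \<and> mono g \<and>
    (\<forall>x\<ge>A + real n * \<eta>. g x = g (A + real n * \<eta>) + (x - (A + real n * \<eta>))) \<and>
    \<bar>g (A + real n * \<eta>) - F (A + real n * \<eta>)\<bar> \<le> \<eta> / \<alpha> \<and>
    (\<forall>x\<in>{A..A + real n * \<eta>}. \<bar>g x - F x\<bar> \<le> 2 * (\<eta> / \<alpha>))"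
proof (induction n)
  case 0
  have "0 \<le> \<eta> / \<alpha>" using \<alpha> \<eta> by simp
  moreover have "mono (\<lambda>y. 1 * y + (F A - A))" by (rule monoI) simp
  ultimately show ?case
    using net_approximable_coord_affine[of \<alpha> j 1 "F A - A"]
    by (intro exI[of _ "\<lambda>y. 1 * y + (F A - A)"]) auto
next
  case (Suc n)
  define p where "p = A + real n * \<eta>"
  from Suc[folded p_def] obtain g where g0: "net_approximable \<alpha> (coord_update j g) \<and> mono g \<and>
    (\<forall>x\<ge>p. g x = g p + (x - p)) \<and> \<bar>g p - F p\<bar> \<le> \<eta> / \<alpha> \<and>
    (\<forall>x\<in>{A..p}. \<bar>g x - F x\<bar> \<le> 2 * (\<eta> / \<alpha>))" ..
  have g: "net_approximable \<alpha> (coord_update j g)" "mono g"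
    "\<And>x. p \<le> x \<Longrightarrow> g x = g p + (x - p)" "\<bar>g p - F p\<bar> \<le> \<eta> / \<alpha>"
    "\<And>x. A \<le> x \<Longrightarrow> x \<le> p \<Longrightarrow> \<bar>g x - F x\<bar> \<le> 2 * (\<eta> / \<alpha>)"
    using g0 atLeastAtMost_iff by blast+
  have p': "A + real (Suc n) * \<eta> = p + \<eta>" by (simp add: p_def algebra_simps)
  define c where "c = g p"
  define \<beta> where "\<beta> = (if c \<ge> F p then \<alpha> else 1 / \<alpha>)"
  have \<beta>: "0 < \<beta>" "\<beta> \<in> {\<alpha>, 1 / \<alpha>}" "1 / \<beta> \<in> {\<alpha>, 1 / \<alpha>}"
    using \<alpha> by (auto simp: \<beta>_def)
  \<comment> \<open>A kink acts on values, so the cell from \<open>p\<close> to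
    \<open>p + \<eta>\<close> is addressed through its values \<open>c\<close> to \<open>c'\<close>.
    The second kink, of factor \<open>1 / \<beta>\<close>, restores slope 1 beyond the cell, as the
    induction hypothesis requires.\<close>
  define c' where "c' = c + \<beta> * \<eta>"
  have c': "c < c'" using \<beta>(1) \<eta> by (simp add: c'_def)
  define g' where "g' = kink c' (1 / \<beta>) \<circ> (kink c \<beta> \<circ> g)"
  have g'_lo: "g' x = g x" if "x \<le> p" for x
    using monoD[OF g(2) that] c' by (simp add: g'_def kink_def c_def)
  have k: "kink c \<beta> (g x) = c + \<beta> * (x - p)" if "p \<le> x" for x
    using g(3)[OF that] that by (auto simp: kink_def c_def)
  have g'_mid: "g' x = c + \<beta> * (x - p)" if "p \<le> x" "x \<le> p + \<eta>" for x
  proof -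
    have "\<beta> * (x - p) \<le> \<beta> * \<eta>" using \<beta>(1) that by simp
    then show ?thesis using k[OF that(1)] by (simp add: g'_def kink_def c'_def)
  qed
  have g'_hi: "g' x = c' + (x - (p + \<eta>))" if "p + \<eta> \<le> x" for x
  proof -
    have "\<beta> * \<eta> \<le> \<beta> * (x - p)" using \<beta>(1) that by simp
    then have "g' x = c' + (1 / \<beta>) * (\<beta> * (x - p) - \<beta> * \<eta>)"
      using k[of x] that \<eta> by (auto simp: g'_def kink_def c'_def)
    also have "\<dots> = c' + (x - (p + \<eta>))"
      using \<beta>(1) by (simp add: field_simps)
    finally show ?thesis .
  qed
  have 1: "net_approximable \<alpha> (coord_update j g')"
    unfolding g'_def by (intro net_approximable_coord_comp net_approximable_kink \<alpha> \<beta> g(1))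
  have 2: "mono g'"
    unfolding g'_def using \<beta>(1) g(2)
    by (intro monoI) (simp add: monoD[OF mono_kink] monoD[OF g(2)])
  have 3: "g' x = g' (p + \<eta>) + (x - (p + \<eta>))" if "p + \<eta> \<le> x" for x
    using g'_hi[OF that] g'_hi[of "p + \<eta>"] by simp
  \<comment> \<open>Over one cell \<open>F\<close> gains between \<alpha> \<eta> and
    \<eta>/\<alpha>. A value above the target gains only \<alpha> \<eta>, so the positive error
    cannot grow and the undershoot stays below \<eta>/\<alpha>; the other case is symmetric.\<close>
  have 4: "\<bar>g' (p + \<eta>) - F (p + \<eta>)\<bar> \<le> \<eta> / \<alpha>"
  proof -
    have "0 \<le> \<alpha> * \<eta>" using \<alpha> \<eta> by simp
    then show ?thesis
      using g'_mid[of "p + \<eta>"] \<eta> F[of p "p + \<eta>"] g(4)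
      by (auto simp: \<beta>_def c_def[symmetric] abs_le_iff)
  qed
  have 5: "\<bar>g' x - F x\<bar> \<le> 2 * (\<eta> / \<alpha>)" if x: "A \<le> x" "x \<le> p + \<eta>" for x
  proof (cases "x \<le> p")
    case True
    then show ?thesis using g(5)[OF x(1)] g'_lo by simp
  next
    case False
    have "(x - p) / \<alpha> \<le> \<eta> / \<alpha>" using x \<alpha> by (simp add: divide_right_mono)
    moreover have "0 \<le> \<alpha> * (x - p)" using False \<alpha> by simp
    ultimately show ?thesis
      using g'_mid[of x] F[of p x] g(4) False x
      by (auto simp: \<beta>_def c_def[symmetric] abs_le_iff)
  qed
  show ?case
    unfolding p'
  proof (intro exI[of _ g'] conjI allI impI ballI)
    show "net_approximable \<alpha> (coord_update j g')" by (rule 1)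
    show "mono g'" by (rule 2)
    show "\<bar>g' (p + \<eta>) - F (p + \<eta>)\<bar> \<le> \<eta> / \<alpha>" by (rule 4)
    show "g' x = g' (p + \<eta>) + (x - (p + \<eta>))" if "p + \<eta> \<le> x" for x
      using that by (rule 3)
    show "\<bar>g' x - F x\<bar> \<le> 2 * (\<eta> / \<alpha>)" if "x \<in> {A..p + \<eta>}" for x
      using that by (intro 5) simp_all
  qed
qed

lemma net_approximable_coord_monotone:
  fixes j :: "'n::finite" and F :: "real \<Rightarrow> real"
  assumes \<alpha>: "0 < \<alpha>" "\<alpha> < 1" and cont: "continuous_on UNIV F"
    and F: "\<And>x y. x \<le> y \<Longrightarrow> \<alpha> * (y - x) \<le> F y - F x"
      "\<And>x y. x \<le> y \<Longrightarrow> F y - F x \<le> (y - x) / \<alpha>"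
  shows "net_approximable \<alpha> (coord_update j F)"
proof (rule net_approximable_coord_limit[OF cont])
  fix B \<epsilon> :: real assume "0 < \<epsilon>"
  define \<eta> where "\<eta> = \<epsilon> * \<alpha> / 2"
  have \<eta>: "0 < \<eta>" "2 * (\<eta> / \<alpha>) = \<epsilon>" using \<open>0 < \<epsilon>\<close> \<alpha> by (auto simp: \<eta>_def)
  obtain n :: nat where n: "2 * \<bar>B\<bar> / \<eta> \<le> real n" using real_arch_simple by blast
  then have "2 * \<bar>B\<bar> \<le> real n * \<eta>" using \<eta>(1) by (simp add: field_simps)
  then have "y \<in> {- \<bar>B\<bar>..- \<bar>B\<bar> + real n * \<eta>}" if "\<bar>y\<bar> \<le> B" for y
    using that by auto
  then show "\<exists>g. net_approximable \<alpha> (coord_update j g) \<and> (\<forall>y. \<bar>y\<bar> \<le> B \<longrightarrow> \<bar>g y - F y\<bar> \<le> \<epsilon>)"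
    using greedy_coord_approximation[OF \<alpha> \<eta>(1) F, where A = "- \<bar>B\<bar>" and n = n and j = j] \<eta>(2)
    by metis
qed

lemma abs_cos_diff_le: "\<bar>cos a - cos b\<bar> \<le> \<bar>a - b\<bar>" for a b :: real
proof -
  have "\<bar>cos a - cos b\<bar> = 2 * (\<bar>sin ((a + b) / 2)\<bar> * \<bar>sin ((b - a) / 2)\<bar>)"
    by (simp add: cos_diff_cos abs_mult)
  also have "\<dots> \<le> 2 * (1 * \<bar>(b - a) / 2\<bar>)"
    by (intro mult_left_mono mult_mono abs_sin_x_le_abs_x) auto
  finally show ?thesis by simp
qed

text \<open>The slopes lie between \<alpha> and 2 - \<alpha>, and 2 - \<alpha> \<le> 1/\<alpha> is
  (1 - \<alpha>)^2 \<ge> 0 in disguise.\<close>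

lemma net_approximable_coord_cos:
  fixes j :: "'n::finite"
  assumes \<alpha>: "0 < \<alpha>" "\<alpha> < 1" and c: "\<bar>c\<bar> \<le> 1 - \<alpha>"
  shows "net_approximable \<alpha> (coord_update j (\<lambda>y. y + c * cos (y + b)))"
proof (rule net_approximable_coord_monotone[OF \<alpha>])
  show "continuous_on UNIV (\<lambda>y. y + c * cos (y + b))"
    by (intro continuous_intros)
  fix x y :: real assume "x \<le> y"
  have "\<bar>c * (cos (y + b) - cos (x + b))\<bar> \<le> (1 - \<alpha>) * (y - x)"
    unfolding abs_mult using abs_cos_diff_le[of "y + b" "x + b"] c \<alpha> \<open>x \<le> y\<close>
    by (intro mult_mono) auto
  then have *: "\<bar>c * cos (y + b) - c * cos (x + b)\<bar> \<le> (1 - \<alpha>) * (y - x)"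
    by (simp add: algebra_simps)
  then show "\<alpha> * (y - x) \<le> y + c * cos (y + b) - (x + c * cos (x + b))"
    by (auto simp: algebra_simps abs_le_iff)
  have "0 \<le> (1 - \<alpha>)\<^sup>2" by simp
  then have "2 - \<alpha> \<le> 1 / \<alpha>" using \<alpha> by (simp add: field_simps power2_eq_square)
  then have "(2 - \<alpha>) * (y - x) \<le> 1 / \<alpha> * (y - x)" using \<open>x \<le> y\<close> by (intro mult_right_mono) auto
  then show "y + c * cos (y + b) - (x + c * cos (x + b)) \<le> (y - x) / \<alpha>"
    using * by (auto simp: algebra_simps abs_le_iff)
qed

text \<open>If the \<open>j\<close>-th entry of \<open>w\<close> is nonzero, the linear map
  \<open>P\<close> makes w \<bullet> x the \<open>j\<close>-th coordinate and \<open>Q\<close> is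
  its inverse. Adding a cos(...) to the old coordinate adds that entry times as much to the new one,
  whence the factor in \<open>F\<close>. If the entry is zero, the map is a limit of such cases with
  \<open>w\<close> slightly tilted towards the \<open>j\<close>-th axis.\<close>

lemma net_approximable_ridge_cos:
  fixes w :: "real ^ 'n"
  assumes \<alpha>: "0 < \<alpha>" "\<alpha> < 1" and a: "\<bar>a * w $ j\<bar> \<le> 1 - \<alpha>"
  shows "net_approximable \<alpha> (\<lambda>x. x + (a * cos (w \<bullet> x + b)) *\<^sub>R axis j 1)"
proof -
  have nz: "net_approximable \<alpha> (\<lambda>x. x + (a * cos (w \<bullet> x + b)) *\<^sub>R axis j 1)"
    if a: "\<bar>a * w $ j\<bar> \<le> 1 - \<alpha>" and w: "w $ j \<noteq> 0" for w :: "real ^ 'n"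
  proof -
    define P where "P = (\<lambda>x :: real ^ 'n. x + (w \<bullet> x - x $ j) *\<^sub>R axis j 1)"
    define Q where "Q = (\<lambda>y :: real ^ 'n. y + ((y $ j - w \<bullet> y) / w $ j) *\<^sub>R axis j 1)"
    define F where "F = (\<lambda>y. y + (a * w $ j) * cos (y + b))"
    have "linear P"
      unfolding P_def by (rule linearI) (auto simp: algebra_simps inner_add_right)
    then have P: "net_approximable \<alpha> P"
      using net_approximable_affine[of P \<alpha> 0] by simp
    have "linear Q"
      unfolding Q_def
      by (rule linearI) (auto simp: algebra_simps inner_add_right add_divide_distrib diff_divide_distrib)
    then have Q: "net_approximable \<alpha> Q"
      using net_approximable_affine[of Q \<alpha> 0] by simp
    have UF: "net_approximable \<alpha> (coord_update j F)"
      unfolding F_def using \<alpha> a by (rule net_approximable_coord_cos)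
    have "(Q \<circ> (coord_update j F \<circ> P)) x = x + (a * cos (w \<bullet> x + b)) *\<^sub>R axis j 1" for x
    proof -
      have Pj: "P x $ j = w \<bullet> x" by (simp add: P_def)
      define y where "y = x + (F (w \<bullet> x) - x $ j) *\<^sub>R axis j 1"
      have U: "coord_update j F (P x) = y"
        unfolding coord_update_def Pj by (simp add: y_def P_def algebra_simps)
      have yj: "y $ j = F (w \<bullet> x)" by (simp add: y_def)
      have wy: "w \<bullet> y = w \<bullet> x + (F (w \<bullet> x) - x $ j) * w $ j"
        by (simp add: y_def inner_add_right inner_axis)
      have "F (w \<bullet> x) - x $ j + (y $ j - w \<bullet> y) / w $ j = a * cos (w \<bullet> x + b)"
        unfolding yj wy using w by (simp add: F_def field_simps)
      moreover have "Q y = x + (F (w \<bullet> x) - x $ j + (y $ j - w \<bullet> y) / w $ j) *\<^sub>R axis j 1"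
        unfolding Q_def by (subst (1) y_def) (simp add: scaleR_add_left)
      ultimately show ?thesis by (simp add: U)
    qed
    then have "Q \<circ> (coord_update j F \<circ> P) = (\<lambda>x. x + (a * cos (w \<bullet> x + b)) *\<^sub>R axis j 1)"
      by (rule ext)
    then show ?thesis
      using net_approximable_comp[OF Q net_approximable_comp[OF UF P]] by simp
  qed
  show ?thesis
  proof (cases "w $ j = 0")
    case False
    then show ?thesis using nz[OF a] by simp
  next
    case True
    show ?thesis
    proof (rule net_approximable_limit)
      show "continuous_on UNIV (\<lambda>x. x + (a * cos (w \<bullet> x + b)) *\<^sub>R axis j 1)"
        by (intro continuous_intros)
      fix B \<epsilon> :: real assume "0 < \<epsilon>"
      \<comment> \<open>Small enough for two uses of \<open>small\<close>: r = 1 gives the slope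
        condition for the tilted \<open>w'\<close>, and r = |x_j| gives the error bound on the ball.
        The summands 1 avoid division by zero.\<close>
      define \<delta> where "\<delta> = min (1 - \<alpha>) \<epsilon> / ((\<bar>a\<bar> + 1) * (\<bar>B\<bar> + 1))"
      have pos: "0 < min (1 - \<alpha>) \<epsilon>" "0 < (\<bar>a\<bar> + 1) * (\<bar>B\<bar> + 1)"
        using \<alpha> \<open>0 < \<epsilon>\<close> by (auto intro!: mult_pos_pos)
      then have \<delta>: "0 < \<delta>" by (simp add: \<delta>_def)
      have "\<delta> * ((\<bar>a\<bar> + 1) * (\<bar>B\<bar> + 1)) = min (1 - \<alpha>) \<epsilon>"
        using pos unfolding \<delta>_def by (metis less_irrefl nonzero_eq_divide_eq)
      moreover have "\<delta> * (\<bar>a\<bar> * r) \<le> \<delta> * ((\<bar>a\<bar> + 1) * (\<bar>B\<bar> + 1))" if "0 \<le> r" "r \<le> \<bar>B\<bar> + 1" for r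
        using \<delta> that by (intro mult_left_mono mult_mono) auto
      ultimately have small: "\<delta> * (\<bar>a\<bar> * r) \<le> min (1 - \<alpha>) \<epsilon>" if "0 \<le> r" "r \<le> \<bar>B\<bar> + 1" for r
        using that by simp
      define w' where "w' = w + \<delta> *\<^sub>R axis j 1"
      have w'j: "w' $ j = \<delta>" by (simp add: w'_def True)
      have "\<bar>a * w' $ j\<bar> \<le> 1 - \<alpha>"
        using small[of 1] \<delta> by (simp add: w'j abs_mult mult.commute)
      then have G: "net_approximable \<alpha> (\<lambda>x. x + (a * cos (w' \<bullet> x + b)) *\<^sub>R axis j 1)"
        using \<delta> by (intro nz) (auto simp: w'j)
      have "norm ((x + (a * cos (w' \<bullet> x + b)) *\<^sub>R axis j 1) - (x + (a * cos (w \<bullet> x + b)) *\<^sub>R axis j 1)) \<le> \<epsilon>"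
        if "norm x \<le> B" for x
      proof -
        have xj: "\<bar>x $ j\<bar> \<le> \<bar>B\<bar> + 1"
          using component_le_norm_cart[of x j] that by simp
        have "w' \<bullet> x = w \<bullet> x + \<delta> * x $ j"
          by (simp add: w'_def inner_add_left inner_axis')
        then have "\<bar>cos (w' \<bullet> x + b) - cos (w \<bullet> x + b)\<bar> \<le> \<delta> * \<bar>x $ j\<bar>"
          using abs_cos_diff_le[of "w' \<bullet> x + b" "w \<bullet> x + b"] \<delta> by (simp add: abs_mult)
        then have "\<bar>a\<bar> * \<bar>cos (w' \<bullet> x + b) - cos (w \<bullet> x + b)\<bar> \<le> \<bar>a\<bar> * (\<delta> * \<bar>x $ j\<bar>)"
          by (intro mult_left_mono) auto
        also have "\<dots> \<le> \<epsilon>" using small[OF _ xj] by (simp add: algebra_simps)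
        finally have "\<bar>a * cos (w' \<bullet> x + b) - a * cos (w \<bullet> x + b)\<bar> \<le> \<epsilon>"
          by (simp add: abs_mult right_diff_distrib[symmetric])
        then show ?thesis
          by (simp add: scaleR_diff_left[symmetric])
      qed
      then show "\<exists>G. net_approximable \<alpha> G \<and> (\<forall>x. norm x \<le> B \<longrightarrow>
          norm (G x - (x + (a * cos (w \<bullet> x + b)) *\<^sub>R axis j 1)) \<le> \<epsilon>)"
        using G by (intro exI[of _ "\<lambda>x. x + (a * cos (w' \<bullet> x + b)) *\<^sub>R axis j 1"]) auto
    qed
  qed
qed

subsection \<open>Vector fields with approximable one-step maps\<close>

text \<open>An error O(h^2), uniform in \<open>x\<close>, is the accuracy that splitting preserves.
  The bound and the Lipschitz constant of the field are recorded because the estimate for a sum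
  consumes both.\<close>

definition steppable :: "real \<Rightarrow> (real ^ 'n \<Rightarrow> real ^ 'n) \<Rightarrow> bool" where
  "steppable \<alpha> g \<longleftrightarrow> (\<exists>C. \<forall>x. norm (g x) \<le> C) \<and> (\<exists>L. L-lipschitz_on UNIV g) \<and>
     (\<exists>h0>0. \<exists>M. \<forall>h\<in>{0..h0}. \<exists>\<Phi>. net_approximable \<alpha> \<Phi> \<and>
        (\<forall>x. norm (\<Phi> x - (x + h *\<^sub>R g x)) \<le> M * h\<^sup>2))"

lemma steppable_zero: "steppable \<alpha> (\<lambda>_. 0 :: real ^ 'n)"
proof -
  have "0-lipschitz_on UNIV (\<lambda>_. 0 :: real ^ 'n)"
    by (auto simp: lipschitz_on_def)
  then show ?thesis
    unfolding steppable_def using net_approximable_ident[of \<alpha>]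
    by (intro conjI exI[of _ 0] exI[of _ "1::real"] ballI exI[of _ "\<lambda>x. x"]) auto
qed

lemma steppable_ridge_cos:
  fixes w :: "real ^ 'n"
  assumes "0 < \<alpha>" "\<alpha> < 1"
  shows "steppable \<alpha> (\<lambda>x. (a * cos (w \<bullet> x + b)) *\<^sub>R axis j 1)"
  unfolding steppable_def
proof (intro conjI)
  show "\<exists>C. \<forall>x. norm ((a * cos (w \<bullet> x + b)) *\<^sub>R axis j 1 :: real ^ 'n) \<le> C"
    by (rule exI[of _ "\<bar>a\<bar>"]) (auto simp: abs_mult mult_left_le)
  have "(\<bar>a\<bar> * norm w)-lipschitz_on UNIV (\<lambda>x. (a * cos (w \<bullet> x + b)) *\<^sub>R axis j 1 :: real ^ 'n)"
  proof (rule lipschitz_onI)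
    fix x y :: "real ^ 'n"
    have "\<bar>cos (w \<bullet> x + b) - cos (w \<bullet> y + b)\<bar> \<le> \<bar>w \<bullet> (x - y)\<bar>"
      using abs_cos_diff_le[of "w \<bullet> x + b" "w \<bullet> y + b"] by (simp add: inner_diff_right)
    also have "\<dots> \<le> norm w * norm (x - y)" by (rule Cauchy_Schwarz_ineq2)
    finally have "\<bar>a\<bar> * \<bar>cos (w \<bullet> x + b) - cos (w \<bullet> y + b)\<bar> \<le> \<bar>a\<bar> * (norm w * norm (x - y))"
      by (rule mult_left_mono) simp
    then show "dist ((a * cos (w \<bullet> x + b)) *\<^sub>R axis j 1 :: real ^ 'n) ((a * cos (w \<bullet> y + b)) *\<^sub>R axis j 1)
        \<le> \<bar>a\<bar> * norm w * dist x y"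
      by (simp add: dist_norm scaleR_diff_left[symmetric] right_diff_distrib[symmetric] abs_mult
          mult.assoc)
  qed simp
  then show "\<exists>L. L-lipschitz_on UNIV (\<lambda>x. (a * cos (w \<bullet> x + b)) *\<^sub>R axis j 1 :: real ^ 'n)" ..
  \<comment> \<open>The largest step for which h |a w_j| \<le> 1 - \<alpha> is guaranteed. Up to it
    the Euler step is approximable exactly, so the error constant is 0.\<close>
  define h0 where "h0 = (1 - \<alpha>) / (\<bar>a * w $ j\<bar> + 1)"
  have "0 < h0" using assms by (simp add: h0_def add_nonneg_pos)
  moreover have "\<exists>\<Phi>. net_approximable \<alpha> \<Phi> \<and>
      (\<forall>x. norm (\<Phi> x - (x + h *\<^sub>R ((a * cos (w \<bullet> x + b)) *\<^sub>R axis j 1))) \<le> 0 * h\<^sup>2)"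
    if "h \<in> {0..h0}" for h
  proof -
    have "h * (\<bar>a * w $ j\<bar> + 1) \<le> h0 * (\<bar>a * w $ j\<bar> + 1)" using that by (intro mult_right_mono) auto
    also have "\<dots> = 1 - \<alpha>" unfolding h0_def by (simp add: add_nonneg_eq_0_iff)
    finally have "\<bar>(h * a) * w $ j\<bar> \<le> 1 - \<alpha>"
      using that by (simp add: abs_mult algebra_simps)
    then show ?thesis
      using net_approximable_ridge_cos[OF assms, of "h * a" w j b]
      by (intro exI[of _ "\<lambda>x. x + ((h * a) * cos (w \<bullet> x + b)) *\<^sub>R axis j 1"]) (auto simp: mult.assoc)
  qed
  ultimately show "\<exists>h0>0. \<exists>M. \<forall>h\<in>{0..h0}. \<exists>\<Phi>. net_approximable \<alpha> \<Phi> \<and>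
      (\<forall>x. norm (\<Phi> x - (x + h *\<^sub>R ((a * cos (w \<bullet> x + b)) *\<^sub>R axis j 1 :: real ^ 'n))) \<le> M * h\<^sup>2)"
    by blast
qed

text \<open>Lie splitting: the composition of the two one-step maps has local error \<open>O(h\<^sup>2)\<close>.\<close>
lemma steppable_add:
  fixes f g :: "real ^ 'n \<Rightarrow> real ^ 'n"
  assumes "steppable \<alpha> f" "steppable \<alpha> g"
  shows "steppable \<alpha> (\<lambda>x. f x + g x)"
proof -
  obtain Cf Lf hf Mf where f: "\<And>x. norm (f x) \<le> Cf" "Lf-lipschitz_on UNIV f" "hf > 0"
    "\<And>h. h \<in> {0..hf} \<Longrightarrow> \<exists>\<Phi>. net_approximable \<alpha> \<Phi> \<and>
        (\<forall>x. norm (\<Phi> x - (x + h *\<^sub>R f x)) \<le> Mf * h\<^sup>2)"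
    using assms(1) unfolding steppable_def by blast
  obtain Cg Lg hg Mg where g: "\<And>x. norm (g x) \<le> Cg" "Lg-lipschitz_on UNIV g" "hg > 0"
    "\<And>h. h \<in> {0..hg} \<Longrightarrow> \<exists>\<Phi>. net_approximable \<alpha> \<Phi> \<and>
        (\<forall>x. norm (\<Phi> x - (x + h *\<^sub>R g x)) \<le> Mg * h\<^sup>2)"
    using assms(2) unfolding steppable_def by blast
  have Lf: "0 \<le> Lf" using f(2) by (rule lipschitz_on_nonneg)
  define h0 where "h0 = min hf hg"
  \<comment> \<open>\<open>Mf\<close> and \<open>Mg\<close> are the two local errors. The other
    terms come from evaluating \<open>f\<close> at y = \<Psi> x instead of \<open>x\<close>, where
    |y - x| \<le> |Mg| h0 h + h Cg.\<close>
  define M where "M = Mf + Mg + Lf * Cg + Lf * \<bar>Mg\<bar> * h0"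
  have "\<exists>\<Phi>. net_approximable \<alpha> \<Phi> \<and> (\<forall>x. norm (\<Phi> x - (x + h *\<^sub>R (f x + g x))) \<le> M * h\<^sup>2)"
    if h: "h \<in> {0..h0}" for h
  proof -
    obtain \<Phi> where \<Phi>: "net_approximable \<alpha> \<Phi>" "\<And>x. norm (\<Phi> x - (x + h *\<^sub>R f x)) \<le> Mf * h\<^sup>2"
      using f(4)[of h] h by (auto simp: h0_def)
    obtain \<Psi> where \<Psi>: "net_approximable \<alpha> \<Psi>" "\<And>x. norm (\<Psi> x - (x + h *\<^sub>R g x)) \<le> Mg * h\<^sup>2"
      using g(4)[of h] h by (auto simp: h0_def)
    have "norm ((\<Phi> \<circ> \<Psi>) x - (x + h *\<^sub>R (f x + g x))) \<le> M * h\<^sup>2" for x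
    proof -
      define y where "y = \<Psi> x"
      have h': "0 \<le> h" "h \<le> h0" using h by auto
      have "norm (y - x) \<le> norm (y - (x + h *\<^sub>R g x)) + norm (h *\<^sub>R g x)"
        using norm_triangle_ineq[of "y - (x + h *\<^sub>R g x)" "h *\<^sub>R g x"] by simp
      also have "\<dots> \<le> \<bar>Mg\<bar> * h0 * h + h * Cg"
      proof -
        have "Mg * (h * h) \<le> \<bar>Mg\<bar> * (h0 * h)"
          using h' by (intro mult_mono) auto
        then show ?thesis
          using \<Psi>(2)[of x] mult_left_mono[OF g(1)[of x] h'(1)] h'
          by (simp add: y_def power2_eq_square mult.assoc)
      qed
      finally have "Lf * norm (y - x) \<le> Lf * (\<bar>Mg\<bar> * h0 * h + h * Cg)"
        using Lf by (rule mult_left_mono)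
      then have "norm (f y - f x) \<le> Lf * (\<bar>Mg\<bar> * h0 * h + h * Cg)"
        using lipschitz_onD[OF f(2), of y x] by (simp add: dist_norm)
      then have *: "norm (h *\<^sub>R (f y - f x)) \<le> h * (Lf * (\<bar>Mg\<bar> * h0 * h + h * Cg))"
        using h'(1) by (simp add: mult_left_mono)
      have "(\<Phi> \<circ> \<Psi>) x - (x + h *\<^sub>R (f x + g x))
          = (\<Phi> y - (y + h *\<^sub>R f y)) + (y - (x + h *\<^sub>R g x)) + h *\<^sub>R (f y - f x)"
        by (simp add: y_def algebra_simps)
      also have "norm \<dots> \<le> Mf * h\<^sup>2 + Mg * h\<^sup>2 + h * (Lf * (\<bar>Mg\<bar> * h0 * h + h * Cg))"
        using \<Psi>(2)[of x] by (intro norm_triangle_mono \<Phi>(2) *) (simp add: y_def)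
      also have "\<dots> = M * h\<^sup>2"
        by (simp add: M_def power2_eq_square algebra_simps)
      finally show ?thesis .
    qed
    then show ?thesis using net_approximable_comp[OF \<Phi>(1) \<Psi>(1)] by blast
  qed
  moreover have "0 < h0" using f(3) g(3) by (simp add: h0_def)
  moreover have "norm (f x + g x) \<le> Cf + Cg" for x
    using norm_triangle_mono[OF f(1) g(1)] .
  moreover have "(Lf + Lg)-lipschitz_on UNIV (\<lambda>x. f x + g x)"
    using f(2) g(2) by (rule lipschitz_on_add)
  ultimately show ?thesis unfolding steppable_def by blast
qed

lemma steppable_sum:
  fixes f :: "'i \<Rightarrow> real ^ 'n \<Rightarrow> real ^ 'n"
  assumes "finite I" "\<And>i. i \<in> I \<Longrightarrow> steppable \<alpha> (f i)"
  shows "steppable \<alpha> (\<lambda>x. \<Sum>i\<in>I. f i x)"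
  using assms by (induction I rule: finite_induct) (auto simp: steppable_zero intro: steppable_add)

section \<open>Density of sums of ridge fields\<close>

inductive_set cos_sums :: "(real ^ 'n \<Rightarrow> real) set" where
  ridge: "(\<lambda>x. a * cos (w \<bullet> x + b)) \<in> cos_sums"
| add: "f \<in> cos_sums \<Longrightarrow> g \<in> cos_sums \<Longrightarrow> (\<lambda>x. f x + g x) \<in> cos_sums"

text \<open>The product-to-sum formula turns a product of two ridge cosines into two ridge cosines
  with frequencies w - v and w + v; this is what makes the span an algebra.\<close>

lemma cos_sums_mult_ridge:
  "g \<in> cos_sums \<Longrightarrow> (\<lambda>x. a * cos (w \<bullet> x + b) * g x) \<in> cos_sums"
proof (induction rule: cos_sums.induct)
  case (ridge c v d)
  have "(\<lambda>x. a * cos (w \<bullet> x + b) * (c * cos (v \<bullet> x + d)))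
      = (\<lambda>x. a * c / 2 * cos ((w - v) \<bullet> x + (b - d)) + a * c / 2 * cos ((w + v) \<bullet> x + (b + d)))"
  proof
    fix x
    have "cos (w \<bullet> x + b) * cos (v \<bullet> x + d)
        = (cos ((w - v) \<bullet> x + (b - d)) + cos ((w + v) \<bullet> x + (b + d))) / 2"
      unfolding cos_times_cos by (simp add: inner_diff_left inner_add_left algebra_simps)
    then have "a * c * (cos (w \<bullet> x + b) * cos (v \<bullet> x + d))
        = a * c * ((cos ((w - v) \<bullet> x + (b - d)) + cos ((w + v) \<bullet> x + (b + d))) / 2)"
      by simp
    then show "a * cos (w \<bullet> x + b) * (c * cos (v \<bullet> x + d))
      = a * c / 2 * cos ((w - v) \<bullet> x + (b - d)) + a * c / 2 * cos ((w + v) \<bullet> x + (b + d))"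
      by (simp add: field_simps)
  qed
  then show ?case by (simp only:) (intro cos_sums.intros)
next
  case (add f g)
  then show ?case using cos_sums.add[OF add.IH] by (simp add: distrib_left)
qed

lemma cos_sums_mult: "f \<in> cos_sums \<Longrightarrow> g \<in> cos_sums \<Longrightarrow> (\<lambda>x. f x * g x) \<in> cos_sums"
proof (induction rule: cos_sums.induct)
  case (ridge a w b)
  then show ?case by (rule cos_sums_mult_ridge)
next
  case (add f1 f2)
  then show ?case using cos_sums.add[of "\<lambda>x. f1 x * g x" "\<lambda>x. f2 x * g x"]
    by (simp add: distrib_right)
qed

lemma continuous_on_cos_sums: "f \<in> cos_sums \<Longrightarrow> continuous_on S f"
  by (induction rule: cos_sums.induct) (auto intro!: continuous_intros)

lemma function_ring_on_cos_sums:
  assumes "compact S"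
  shows "function_ring_on cos_sums S"
proof
  fix c :: real
  show "(\<lambda>_. c) \<in> cos_sums"
    using cos_sums.ridge[of c 0 0] by simp
  fix x y :: "real ^ 'n" assume "x \<noteq> y"
  \<comment> \<open>Scaled so that the cosine of w \<bullet> (z - y), as a function of z, takes the
    values cos 1 at \<open>x\<close> and cos 0 at \<open>y\<close>.\<close>
  define w where "w = (1 / ((x - y) \<bullet> (x - y))) *\<^sub>R (x - y)"
  have "w \<bullet> (x - y) = 1"
    unfolding w_def inner_scaleR_left using \<open>x \<noteq> y\<close> by simp
  moreover have "cos (1::real) \<noteq> cos 0"
    using cos_inj_pi[of 1 0] pi_gt3 by auto
  ultimately have "1 * cos (w \<bullet> x + - (w \<bullet> y)) \<noteq> 1 * cos (w \<bullet> y + - (w \<bullet> y))"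
    by (simp add: inner_diff_right)
  then show "\<exists>f\<in>cos_sums. f x \<noteq> f y"
    by (intro bexI[of _ "\<lambda>x. 1 * cos (w \<bullet> x + - (w \<bullet> y))"] cos_sums.ridge)
qed (rule assms continuous_on_cos_sums cos_sums_mult cos_sums.add; assumption)+

lemma steppable_cos_sums:
  fixes f :: "real ^ 'n \<Rightarrow> real"
  assumes "0 < \<alpha>" "\<alpha> < 1" "f \<in> cos_sums"
  shows "steppable \<alpha> (\<lambda>x. f x *\<^sub>R axis j 1)"
  using assms(3)
proof (induction rule: cos_sums.induct)
  case (ridge a w b)
  show ?case by (rule steppable_ridge_cos[OF assms(1,2)])
next
  case (add f g)
  then show ?case using steppable_add[OF add.IH] by (simp add: scaleR_add_left)
qed

lemma steppable_dense:
  fixes u :: "real ^ 'n \<Rightarrow> real ^ 'n"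
  assumes \<alpha>: "0 < \<alpha>" "\<alpha> < 1" and S: "compact S" "continuous_on S u" and "0 < \<epsilon>"
  shows "\<exists>g. steppable \<alpha> g \<and> (\<forall>x\<in>S. norm (g x - u x) \<le> \<epsilon>)"
proof -
  interpret function_ring_on cos_sums S
    using S(1) by (rule function_ring_on_cos_sums)
  \<comment> \<open>Each component gets an equal share of \<epsilon>, since the norm is bounded by
    the sum of the component errors.\<close>
  define \<delta> where "\<delta> = \<epsilon> / real CARD('n)"
  have "0 < \<delta>" using \<open>0 < \<epsilon>\<close> by (simp add: \<delta>_def)
  then have "\<exists>f\<in>cos_sums. \<forall>x\<in>S. \<bar>u x $ j - f x\<bar> < \<delta>" for j
    by (intro Stone_Weierstrass_basic continuous_intros S(2))
  then obtain f where f: "\<And>j. f j \<in> cos_sums" "\<And>j x. x \<in> S \<Longrightarrow> \<bar>u x $ j - f j x\<bar> < \<delta>"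
    by metis
  define g :: "real ^ 'n \<Rightarrow> real ^ 'n" where "g x = (\<Sum>j\<in>UNIV. f j x *\<^sub>R axis j 1)" for x
  have "steppable \<alpha> g"
    unfolding g_def[abs_def] by (intro steppable_sum steppable_cos_sums \<alpha> f(1)) auto
  moreover have "norm (g x - u x) \<le> \<epsilon>" if "x \<in> S" for x
  proof -
    have gj: "g x $ j = f j x" for j
      by (simp add: g_def axis_def if_distrib cong: if_cong)
    have "norm (g x - u x) \<le> (\<Sum>j\<in>UNIV. \<bar>(g x - u x) $ j\<bar>)"
      by (rule norm_le_l1_cart)
    also have "\<dots> \<le> of_nat CARD('n) * \<delta>"
      using f(2)[OF that] by (intro sum_bounded_above) (simp add: gj abs_minus_commute less_imp_le)
    finally show ?thesis by (simp add: \<delta>_def)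
  qed
  ultimately show ?thesis by blast
qed

subsection \<open>Solutions of a centred Lipschitz field\<close>

lemma integrable_on_greaterThanLessThan_iff:
  fixes f :: "real \<Rightarrow> 'a::banach"
  shows "f integrable_on {a<..<b} \<longleftrightarrow> f integrable_on {a..b}"
  using integrable_on_open_interval[of f a b] by simp

lemma has_integral_exp_scaled:
  fixes c k t :: real
  assumes "k \<noteq> 0" "0 \<le> t"
  shows "((\<lambda>r. c * exp (k * r)) has_integral (c / k * (exp (k * t) - 1))) {0..t}"
proof -
  have "((\<lambda>r. c * exp (k * r)) has_integral (c / k * exp (k * t) - c / k * exp (k * 0))) {0..t}"
    by (intro fundamental_theorem_of_calculus)
      (use assms in \<open>auto intro!: derivative_eq_intros simp: has_real_derivative_iff_has_vector_derivative[symmetric]\<close>)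
  then show ?thesis by (simp add: algebra_simps)
qed

text \<open>A weak form of Gronwall's inequality: compare at the maximum of \<open>exp (- 2 K t) * norm (D t)\<close>.\<close>
lemma weak_gronwall:
  fixes D :: "real \<Rightarrow> 'a::euclidean_space"
  assumes K: "0 < K" and cont: "continuous_on {0..T} D"
    and le: "\<And>t. t \<in> {0..T} \<Longrightarrow> norm (D t) \<le> A + integral {0..t} (\<lambda>r. K * norm (D r))"
    and t: "t \<in> {0..T}"
  shows "norm (D t) \<le> 2 * A * exp (2 * K * t)"
proof -
  have "continuous_on {0..T} (\<lambda>t. exp (- (2 * K * t)) * norm (D t))"
    by (intro continuous_intros cont)
  then obtain t0 where t0: "t0 \<in> {0..T}"
    "\<And>t. t \<in> {0..T} \<Longrightarrow> exp (- (2 * K * t)) * norm (D t) \<le> exp (- (2 * K * t0)) * norm (D t0)"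
    using continuous_attains_sup[of "{0..T}" "\<lambda>t. exp (- (2 * K * t)) * norm (D t)"] t by auto
  \<comment> \<open>The weight has rate 2K rather than K, so the integral term contributes at most
    \<open>M / 2\<close>. Then M \<le> A + M/2 yields the factor 2 of the conclusion.\<close>
  define M where "M = exp (- (2 * K * t0)) * norm (D t0)"
  have D: "norm (D r) \<le> M * exp (2 * K * r)" if "r \<in> {0..T}" for r
  proof -
    have "norm (D r) = exp (2 * K * r) * (exp (- (2 * K * r)) * norm (D r))"
      by (simp add: exp_minus)
    also have "\<dots> \<le> exp (2 * K * r) * M"
      unfolding M_def by (intro mult_left_mono t0(2) that) simp
    finally show ?thesis by (simp add: mult.commute)
  qed
  have "0 \<le> A" using le[of 0] t norm_ge_zero[of "D 0"] by (simp del: norm_ge_zero)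
  have "0 \<le> M" by (simp add: M_def)
  have I: "((\<lambda>r. K * M * exp (2 * K * r)) has_integral (K * M / (2 * K) * (exp (2 * K * t0) - 1))) {0..t0}"
    using K t0(1) by (intro has_integral_exp_scaled) auto
  have "norm (D t0) \<le> A + integral {0..t0} (\<lambda>r. K * norm (D r))"
    by (rule le[OF t0(1)])
  also have "integral {0..t0} (\<lambda>r. K * norm (D r)) \<le> integral {0..t0} (\<lambda>r. K * M * exp (2 * K * r))"
  proof (rule integral_le)
    show "(\<lambda>r. K * norm (D r)) integrable_on {0..t0}"
      using t0(1) by (intro integrable_continuous_real continuous_intros continuous_on_subset[OF cont]) auto
    show "K * norm (D r) \<le> K * M * exp (2 * K * r)" if "r \<in> {0..t0}" for r
      using mult_left_mono[OF D[of r], of K] that t0(1) K by (auto simp: mult.assoc)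
  qed (use I in blast)
  also have "\<dots> = M / 2 * (exp (2 * K * t0) - 1)"
    using integral_unique[OF I] K by simp
  also have "\<dots> \<le> M / 2 * exp (2 * K * t0)"
    using \<open>0 \<le> M\<close> by (intro mult_left_mono) auto
  finally have "exp (- (2 * K * t0)) * norm (D t0) \<le> exp (- (2 * K * t0)) * (A + M / 2 * exp (2 * K * t0))"
    by (intro mult_left_mono) auto
  moreover have "exp (- (2 * K * t0)) * (M / 2 * exp (2 * K * t0)) = M / 2"
    by (simp add: exp_minus)
  ultimately have "M \<le> exp (- (2 * K * t0)) * A + M / 2"
    unfolding M_def[symmetric] distrib_left by linarith
  also have "exp (- (2 * K * t0)) * A \<le> A"
    using K t0(1) \<open>0 \<le> A\<close> by (intro mult_left_le_one_le) auto
  finally have "M \<le> 2 * A" by simp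
  then have "M * exp (2 * K * t) \<le> 2 * A * exp (2 * K * t)" by simp
  then show ?thesis using D[OF t] by linarith
qed

text \<open>The Lipschitz bound together with \<open>zero\<close> makes the field bounded on balls
  uniformly in time, up to the breakpoints. Both conditions range over all times, so no time
  restriction has to be carried through the estimates.\<close>

locale centred_field =
  fixes w :: "real ^ 'n \<Rightarrow> real \<Rightarrow> real ^ 'n" and \<tau> K :: real and m :: nat and s :: "nat \<Rightarrow> real"
  assumes K_pos: "0 < K"
    and lipschitz: "norm (w x t - w y t) \<le> K * norm (x - y)"
    and zero: "w 0 t = 0"
    and s_0: "s 0 = 0" and s_m: "s m = \<tau>" and s_Suc: "i < m \<Longrightarrow> s i < s (Suc i)"
    and cont: "i < m \<Longrightarrow> continuous_on (UNIV \<times> {s i<..<s (Suc i)}) (\<lambda>(x, t). w x t)"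
begin

lemma norm_w_le:
  assumes "norm x \<le> R"
  shows "norm (w x t) \<le> K * R"
proof -
  have "norm (w x t) \<le> K * norm x" using lipschitz[of x t 0] by (simp add: zero)
  also have "\<dots> \<le> K * R" using assms K_pos by (intro mult_left_mono) auto
  finally show ?thesis .
qed

lemma s_le:
  assumes "i \<le> j" "j \<le> m"
  shows "s i \<le> s j"
  using assms
proof (induction j)
  case (Suc j)
  then show ?case using s_Suc[of j] by (cases "i = Suc j") auto
qed simp

lemma s_range: "i \<le> m \<Longrightarrow> 0 \<le> s i \<and> s i \<le> \<tau>"
  using s_le[of 0 i] s_le[of i m] by (simp add: s_0 s_m)

lemma tau_nonneg: "0 \<le> \<tau>"
  using s_range[of m] by (simp add: s_m)

text \<open>A continuous curve on the compact interval stays in a ball, where the field is bounded.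
  On each open piece the integrand is thus continuous and bounded; the breakpoints are negligible
  and the pieces are glued.\<close>

lemma integrable_along:
  assumes y: "continuous_on {0..\<tau>} y"
  shows "(\<lambda>t. w (y t) t) integrable_on {0..\<tau>}"
proof -
  have "bounded (y ` {0..\<tau>})"
    by (intro compact_imp_bounded compact_continuous_image y) simp
  then obtain B where B: "\<And>t. t \<in> {0..\<tau>} \<Longrightarrow> norm (y t) \<le> B"
    unfolding bounded_iff by blast
  have piece: "(\<lambda>t. w (y t) t) integrable_on {s i..s (Suc i)}" if i: "i < m" for i
  proof -
    have sub: "{s i<..<s (Suc i)} \<subseteq> {0..\<tau>}"
      using s_range[of i] s_range[of "Suc i"] i by auto
    have "continuous_on {s i<..<s (Suc i)} (\<lambda>t. (\<lambda>(x, t). w x t) (y t, t))"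
      by (rule continuous_on_compose2[OF cont[OF i]])
        (auto intro!: continuous_intros continuous_on_subset[OF y sub])
    then have "(\<lambda>t. w (y t) t) \<in> borel_measurable (lebesgue_on {s i<..<s (Suc i)})"
      by (intro continuous_imp_measurable_on_sets_lebesgue) auto
    then have "(\<lambda>t. w (y t) t) integrable_on {s i<..<s (Suc i)}"
    proof (rule measurable_bounded_by_integrable_imp_integrable)
      show "(\<lambda>_. K * B) integrable_on {s i<..<s (Suc i)}"
        using integrable_const_ivl[of "K * B" "s i" "s (Suc i)"]
        by (simp only: integrable_on_greaterThanLessThan_iff)
      show "norm (w (y t) t) \<le> K * B" if "t \<in> {s i<..<s (Suc i)}" for t
        by (intro norm_w_le B subsetD[OF sub that])
    qed simp
    then show ?thesis by (simp add: integrable_on_greaterThanLessThan_iff)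
  qed
  have "i \<le> m \<Longrightarrow> (\<lambda>t. w (y t) t) integrable_on {0..s i}" for i
  proof (induction i)
    case (Suc i)
    then show ?case
      using Henstock_Kurzweil_Integration.integrable_combine[OF _ _ Suc.IH piece[of i]] s_range[of i] s_Suc[of i]
      by simp
  qed (use integrable_on_refl[of "\<lambda>t. w (y t) t" 0] in \<open>simp add: s_0\<close>)
  from this[of m] show ?thesis by (simp add: s_m)
qed

lemma integrable_along_sub:
  assumes "continuous_on {0..\<tau>} y" "0 \<le> a" "b \<le> \<tau>"
  shows "(\<lambda>t. w (y t) t) integrable_on {a..b}"
  using integrable_subinterval_real[OF integrable_along[OF assms(1)], of a b] assms by simp

text \<open>Picard iteration for \<open>u t = exp (- 2 K t) * Y t\<close>, which contracts on all of \<open>[0, \<tau>]\<close>.\<close>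
lemma solution_exists: "\<exists>Y. ode_solution w \<tau> y0 Y"
proof -
  define Y where "Y u r = exp (2 * K * r) *\<^sub>R apply_bcontfun u r" for u :: "real \<Rightarrow>\<^sub>C (real ^ 'n)" and r
  define G where "G u t = exp (- (2 * K * t)) *\<^sub>R (y0 + integral {0..t} (\<lambda>r. w (Y u r) r))" for u t
  \<comment> \<open>Clamping the time to the interval from 0 to \<tau> extends \<open>G u\<close> to
    a bounded continuous function on the line, so that the complete space of such functions can be
    used.\<close>
  define T where "T u = Bcontfun (\<lambda>t. G u (max 0 (min \<tau> t)))" for u
  have Y: "continuous_on S (Y u)" for S u
    unfolding Y_def by (intro continuous_intros continuous_on_apply_bcontfun)
  have clamp: "max 0 (min \<tau> t) \<in> {0..\<tau>}" for t using tau_nonneg by auto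
  have G: "continuous_on {0..\<tau>} (G u)" for u
    unfolding G_def
    by (intro continuous_intros indefinite_integral_continuous_1 integrable_along Y)
  have T: "apply_bcontfun (T u) t = G u (max 0 (min \<tau> t))" for u t
  proof -
    have "continuous_on UNIV (\<lambda>t. G u (max 0 (min \<tau> t)))"
      by (rule continuous_on_compose2[OF G]) (use clamp in \<open>auto intro!: continuous_intros\<close>)
    moreover have "bounded (range (\<lambda>t. G u (max 0 (min \<tau> t))))"
      by (rule bounded_subset[of "G u ` {0..\<tau>}"])
        (use clamp in \<open>auto intro!: compact_imp_bounded compact_continuous_image G\<close>)
    ultimately have "(\<lambda>t. G u (max 0 (min \<tau> t))) \<in> bcontfun"
      by (simp add: bcontfun_def)
    then show ?thesis by (simp add: T_def Bcontfun_inverse)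
  qed
  \<comment> \<open>The curves differ by at most exp (2 K r) times the distance of \<open>u\<close>
    and \<open>u'\<close>. Integrating K times this gives half that distance times exp (2 K t) - 1,
    and the weight in \<open>G\<close> removes the exponential.\<close>
  have contract: "dist (T u) (T u') \<le> 1 / 2 * dist u u'" for u u'
  proof (rule dist_bound)
    fix t'
    define t where "t = max 0 (min \<tau> t')"
    have t: "0 \<le> t" "t \<le> \<tau>" using clamp[of t'] by (auto simp: t_def)
    have int: "(\<lambda>r. w (Y u r) r) integrable_on {0..t}" for u
      using t by (intro integrable_along_sub Y) auto
    have I: "((\<lambda>r. K * dist u u' * exp (2 * K * r)) has_integral
        (K * dist u u' / (2 * K) * (exp (2 * K * t) - 1))) {0..t}"
      using K_pos t by (intro has_integral_exp_scaled) auto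
    have "norm (integral {0..t} (\<lambda>r. w (Y u r) r) - integral {0..t} (\<lambda>r. w (Y u' r) r))
        = norm (integral {0..t} (\<lambda>r. w (Y u r) r - w (Y u' r) r))"
      by (simp add: Henstock_Kurzweil_Integration.integral_diff int)
    also have "\<dots> \<le> integral {0..t} (\<lambda>r. K * dist u u' * exp (2 * K * r))"
    proof (rule integral_norm_bound_integral)
      fix r assume "r \<in> {0..t}"
      have "norm (w (Y u r) r - w (Y u' r) r) \<le> K * norm (Y u r - Y u' r)"
        by (rule lipschitz)
      also have "norm (Y u r - Y u' r) = exp (2 * K * r) * dist (apply_bcontfun u r) (apply_bcontfun u' r)"
        by (simp add: Y_def scaleR_diff_right[symmetric] dist_norm)
      also have "K * \<dots> \<le> K * (exp (2 * K * r) * dist u u')"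
        using K_pos by (intro mult_left_mono dist_bounded) auto
      finally show "norm (w (Y u r) r - w (Y u' r) r) \<le> K * dist u u' * exp (2 * K * r)"
        by (simp add: mult.assoc mult.left_commute mult.commute)
    qed (use int I in \<open>auto intro: integrable_diff\<close>)
    also have "\<dots> = dist u u' / 2 * (exp (2 * K * t) - 1)"
      using integral_unique[OF I] K_pos by simp
    also have "\<dots> \<le> dist u u' / 2 * exp (2 * K * t)"
      by (intro mult_left_mono) auto
    finally have "exp (- (2 * K * t)) *
        norm (integral {0..t} (\<lambda>r. w (Y u r) r) - integral {0..t} (\<lambda>r. w (Y u' r) r))
        \<le> exp (- (2 * K * t)) * (dist u u' / 2 * exp (2 * K * t))"
      by (intro mult_left_mono) auto
    also have "\<dots> = 1 / 2 * dist u u'"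
      by (simp add: mult.left_commute[of "exp _" "dist u u' / 2"] exp_add[symmetric])
    finally show "dist (apply_bcontfun (T u) t') (apply_bcontfun (T u') t') \<le> 1 / 2 * dist u u'"
      by (simp add: T t_def[symmetric] G_def dist_norm scaleR_diff_right[symmetric])
  qed
  have "\<exists>!u. u \<in> UNIV \<and> T u = u"
    by (rule Banach_fix[where c = "1/2"]) (use contract in auto)
  then obtain u where u: "T u = u" by blast
  have Yu: "Y u t = y0 + integral {0..t} (\<lambda>r. w (Y u r) r)" if "t \<in> {0..\<tau>}" for t
  proof -
    have "apply_bcontfun u t = G u t"
      using T[of u t] that by (simp add: u)
    then show ?thesis
      by (subst Y_def) (simp add: G_def exp_add[symmetric])
  qed
  have "ode_solution w \<tau> y0 (Y u)"
    unfolding ode_solution_def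
  proof (intro conjI ballI)
    show "continuous_on {0..\<tau>} (Y u)" by (rule Y)
    show "Y u 0 = y0" using Yu[of 0] tau_nonneg by simp
    fix t assume t: "t \<in> {0..\<tau>}"
    show "((\<lambda>r. w (Y u r) r) has_integral (Y u t - y0)) {0..t}"
      using integrable_along_sub[OF Y, of 0 t u] t by (subst Yu[OF t]) (auto intro: integrable_integral)
  qed
  then show ?thesis by blast
qed

lemma norm_solution_diff_le:
  assumes X: "ode_solution w \<tau> x0 X" and Y: "ode_solution w \<tau> y0 Y" and t: "t \<in> {0..\<tau>}"
  shows "norm (X t - Y t) \<le> 2 * norm (x0 - y0) * exp (2 * K * t)"
proof (rule weak_gronwall[OF K_pos _ _ t])
  have cX: "continuous_on {0..\<tau>} X" and cY: "continuous_on {0..\<tau>} Y"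
    using X Y by (auto simp: ode_solution_def)
  then show cXY: "continuous_on {0..\<tau>} (\<lambda>t. X t - Y t)" by (intro continuous_intros)
  fix t assume t: "t \<in> {0..\<tau>}"
  have "((\<lambda>r. w (X r) r - w (Y r) r) has_integral ((X t - x0) - (Y t - y0))) {0..t}"
    using X Y t by (intro has_integral_diff) (auto simp: ode_solution_def)
  then have "norm ((X t - x0) - (Y t - y0)) = norm (integral {0..t} (\<lambda>r. w (X r) r - w (Y r) r))"
    and int: "(\<lambda>r. w (X r) r - w (Y r) r) integrable_on {0..t}"
    by (auto simp: integral_unique)
  moreover have "norm (integral {0..t} (\<lambda>r. w (X r) r - w (Y r) r))
      \<le> integral {0..t} (\<lambda>r. K * norm (X r - Y r))"
    using t by (intro integral_norm_bound_integral int integrable_continuous_real continuous_intros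
        continuous_on_subset[OF cX] continuous_on_subset[OF cY] lipschitz) auto
  ultimately have "norm ((X t - x0) - (Y t - y0)) \<le> integral {0..t} (\<lambda>r. K * norm (X r - Y r))"
    by simp
  then show "norm (X t - Y t) \<le> norm (x0 - y0) + integral {0..t} (\<lambda>r. K * norm (X r - Y r))"
    using norm_triangle_ineq[of "x0 - y0" "(X t - x0) - (Y t - y0)"] by simp
qed

end

subsection \<open>Following solutions by networks\<close>

text \<open>Serves to choose step sizes; the summand 1 in the denominator covers C = 0.\<close>

lemma mult_le_of_le_divide:
  fixes c C h \<delta> :: real
  assumes "c \<le> C" "0 \<le> C" "0 \<le> h" "h \<le> \<delta> / (C + 1)"
  shows "c * h \<le> \<delta>"
proof -
  have "c * h \<le> (C + 1) * h" using assms by (intro mult_right_mono) auto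
  also have "\<dots> \<le> \<delta>" using assms by (simp add: pos_le_divide_eq mult.commute)
  finally show ?thesis .
qed

context centred_field
begin

lemma solution_zero: "ode_solution w \<tau> 0 (\<lambda>_. 0)"
  by (simp add: ode_solution_def zero)

lemma norm_solution_le:
  assumes "ode_solution w \<tau> y0 Y" "t \<in> {0..\<tau>}"
  shows "norm (Y t) \<le> 2 * norm y0 * exp (2 * K * \<tau>)"
proof -
  have "norm (Y t) \<le> 2 * norm y0 * exp (2 * K * t)"
    using norm_solution_diff_le[OF assms(1) solution_zero assms(2)] by simp
  also have "\<dots> \<le> 2 * norm y0 * exp (2 * K * \<tau>)"
    using assms(2) K_pos by (intro mult_left_mono) auto
  finally show ?thesis .
qed

lemma solution_unique:
  assumes "ode_solution w \<tau> y0 X" "ode_solution w \<tau> y0 Y" "t \<in> {0..\<tau>}"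
  shows "X t = Y t"
  using norm_solution_diff_le[OF assms] by simp

lemma solution_has_integral:
  assumes Y: "ode_solution w \<tau> y0 Y" and ab: "0 \<le> a" "a \<le> b" "b \<le> \<tau>"
  shows "((\<lambda>r. w (Y r) r) has_integral (Y b - Y a)) {a..b}"
proof -
  have cY: "continuous_on {0..\<tau>} Y" using Y by (simp add: ode_solution_def)
  have I: "integral {0..t} (\<lambda>r. w (Y r) r) = Y t - y0" if "t \<in> {0..\<tau>}" for t
    using Y that by (auto simp: ode_solution_def integral_unique)
  have "integral {0..a} (\<lambda>r. w (Y r) r) + integral {a..b} (\<lambda>r. w (Y r) r)
      = integral {0..b} (\<lambda>r. w (Y r) r)"
    using ab by (intro Henstock_Kurzweil_Integration.integral_combine integrable_along_sub cY) auto
  then have "integral {a..b} (\<lambda>r. w (Y r) r) = Y b - Y a"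
    using I[of a] I[of b] ab by (simp add: algebra_simps)
  then show ?thesis
    using integrable_integral[OF integrable_along_sub[OF cY ab(1,3)]] by simp
qed

text \<open>A single network has to serve all initial values, so estimates are made uniformly over
  the solutions confined to one ball.\<close>

definition solutions_within :: "real \<Rightarrow> (real \<Rightarrow> real ^ 'n) set" where
  "solutions_within R = {Y. (\<exists>y0. ode_solution w \<tau> y0 Y) \<and> (\<forall>t\<in>{0..\<tau>}. norm (Y t) \<le> R)}"

lemma solutions_within_speed:
  assumes Y: "Y \<in> solutions_within R" and ab: "0 \<le> a" "a \<le> b" "b \<le> \<tau>" and "0 \<le> R"
  shows "norm (Y b - Y a) \<le> K * R * (b - a)"
proof -
  obtain y0 where y0: "ode_solution w \<tau> y0 Y" using Y by (auto simp: solutions_within_def)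
  have "norm (Y b - Y a) \<le> K * R * measure lborel (cbox a b)"
  proof (rule has_integral_bound)
    show "((\<lambda>r. w (Y r) r) has_integral (Y b - Y a)) (cbox a b)"
      using solution_has_integral[OF y0 ab] by simp
    fix r assume "r \<in> cbox a b"
    then have "norm (Y r) \<le> R" using Y ab by (auto simp: solutions_within_def)
    then show "norm (w (Y r) r) \<le> K * R" by (rule norm_w_le)
  qed (use K_pos \<open>0 \<le> R\<close> in simp)
  then show ?thesis using ab by simp
qed

text \<open>Stated for tubes around solutions instead of points on them: the inexact output of one
  stage is then an admissible input of the next, and \<open>F\<close> does not depend on the
  solution.\<close>

definition tracks :: "real \<Rightarrow> real \<Rightarrow> real \<Rightarrow> real \<Rightarrow> real \<Rightarrow> real \<Rightarrow> bool" where
  "tracks \<alpha> R p e q f \<longleftrightarrow> (\<exists>F. net_approximable \<alpha> F \<and>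
     (\<forall>Y\<in>solutions_within R. \<forall>z. norm (z - Y p) \<le> e \<longrightarrow> norm (F z - Y q) \<le> f))"

lemma tracks_trans: "tracks \<alpha> R p e q f \<Longrightarrow> tracks \<alpha> R q f r g \<Longrightarrow> tracks \<alpha> R p e r g"
  unfolding tracks_def
proof (elim exE conjE)
  fix F G
  assume F: "net_approximable \<alpha> F" "\<forall>Y\<in>solutions_within R. \<forall>z. norm (z - Y p) \<le> e \<longrightarrow> norm (F z - Y q) \<le> f"
    and G: "net_approximable \<alpha> G" "\<forall>Y\<in>solutions_within R. \<forall>z. norm (z - Y q) \<le> f \<longrightarrow> norm (G z - Y r) \<le> g"
  show "\<exists>H. net_approximable \<alpha> H \<and>
      (\<forall>Y\<in>solutions_within R. \<forall>z. norm (z - Y p) \<le> e \<longrightarrow> norm (H z - Y r) \<le> g)"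
    using net_approximable_comp[OF G(1) F(1)] F(2) G(2) by (intro exI[of _ "G \<circ> F"]) simp
qed

lemma tracks_mono: "tracks \<alpha> R p e q f \<Longrightarrow> e' \<le> e \<Longrightarrow> f \<le> f' \<Longrightarrow> tracks \<alpha> R p e' q f'"
  unfolding tracks_def by (meson order_trans)

lemma tracks_wait:
  assumes "0 \<le> p" "p \<le> q" "q \<le> \<tau>" "0 \<le> R"
  shows "tracks \<alpha> R p e q (e + K * R * (q - p))"
  unfolding tracks_def
proof (intro exI[of _ "\<lambda>z. z"] conjI ballI allI impI)
  show "net_approximable \<alpha> (\<lambda>z :: real ^ 'n. z)" by (rule net_approximable_ident)
  fix Y z assume "Y \<in> solutions_within R" "norm (z - Y p) \<le> e"
  then show "norm (z - Y q) \<le> e + K * R * (q - p)"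
    using solutions_within_speed[of Y R p q] assms
      norm_triangle_le_diff[of "z - Y p" "Y q - Y p" "e + K * R * (q - p)"] by simp
qed

text \<open>Since \<open>\<epsilon> \<le> e\<close>, the additive error \<open>\<epsilon> * h\<close> of an Euler step is absorbed into the factor
  \<open>exp ((K + 1) * h)\<close>; this makes the error bounds of adjacent intervals compose exactly.\<close>
lemma tracks_local:
  assumes \<alpha>: "0 < \<alpha>" "\<alpha> < 1" and R: "0 \<le> R" and i: "i < m"
    and x: "s i < x" "x < s (Suc i)" and \<epsilon>: "0 < \<epsilon>"
  shows "\<exists>d>0. \<forall>a b e. a \<le> x \<and> x \<le> b \<and> b - a < d \<and> \<epsilon> \<le> e \<and> e \<le> 1 \<longrightarrow>
    tracks \<alpha> R a e b (e * exp ((K + 1) * (b - a)))"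
proof -
  define \<rho> where "\<rho> = min (x - s i) (s (Suc i) - x) / 2"
  have \<rho>: "0 < \<rho>" "s i < x - \<rho>" "x + \<rho> < s (Suc i)"
    using x by (auto simp: \<rho>_def min_def field_simps)
  \<comment> \<open>The radius is \<open>R + 1\<close> because a tracked point lies within e \<le> 1
    of a solution of norm at most \<open>R\<close>; \<rho> keeps the times away from the
    breakpoints.\<close>
  define Q where "Q = cball (0 :: real ^ 'n) (R + 1) \<times> {x - \<rho>..x + \<rho>}"
  have "Q \<subseteq> UNIV \<times> {s i<..<s (Suc i)}" using \<rho> by (auto simp: Q_def)
  then have cQ: "continuous_on Q (\<lambda>(z, t). w z t)"
    by (rule continuous_on_subset[OF cont[OF i]])
  have "uniformly_continuous_on Q (\<lambda>(z, t). w z t)"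
    by (intro compact_uniformly_continuous cQ) (simp add: Q_def compact_Times)
  then obtain \<delta> where \<delta>: "\<delta> > 0"
    "\<And>p q. p \<in> Q \<Longrightarrow> q \<in> Q \<Longrightarrow> dist q p < \<delta> \<Longrightarrow> dist (case q of (z, t) \<Rightarrow> w z t) (case p of (z, t) \<Rightarrow> w z t) < \<epsilon> / 4"
    unfolding uniformly_continuous_on_def using \<epsilon> by (metis zero_less_divide_iff zero_less_numeral)
  have time: "norm (w z x - w z t) \<le> \<epsilon> / 4" if "norm z \<le> R + 1" "\<bar>t - x\<bar> < \<delta>" "\<bar>t - x\<bar> \<le> \<rho>" for z t
    using \<delta>(2)[of "(z, t)" "(z, x)"] that \<rho>
    by (simp add: Q_def dist_Pair_Pair dist_norm abs_minus_commute abs_le_iff)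
  have "continuous_on (cball 0 (R + 1)) (\<lambda>z. (\<lambda>(z, t). w z t) (z, x))"
    by (rule continuous_on_compose2[OF cQ]) (use \<rho> in \<open>auto simp: Q_def intro!: continuous_intros\<close>)
  then obtain g where g: "steppable \<alpha> g" "\<And>z. norm z \<le> R + 1 \<Longrightarrow> norm (g z - w z x) \<le> \<epsilon> / 4"
    using steppable_dense[OF \<alpha>, of "cball 0 (R + 1)" "\<lambda>z. w z x" "\<epsilon> / 4"] \<epsilon>
    by auto
  obtain h0 M where h0: "h0 > 0" and M: "\<And>h. h \<in> {0..h0} \<Longrightarrow>
      \<exists>\<Phi>. net_approximable \<alpha> \<Phi> \<and> (\<forall>x. norm (\<Phi> x - (x + h *\<^sub>R g x)) \<le> M * h\<^sup>2)"
    using g(1) unfolding steppable_def by blast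
  \<comment> \<open>In turn: stay in \<open>Q\<close>, freeze the time at \<open>x\<close>, have a
    one-step map available, make its error at most \<epsilon>/4 per unit time, and make the drift K
    R h of the solution cost at most \<epsilon>/4 after the Lipschitz bound.\<close>
  define d where "d = Min {\<rho>, \<delta>, h0, \<epsilon> / 4 / (\<bar>M\<bar> + 1), \<epsilon> / 4 / (K * (K * R) + 1)}"
  have pos: "0 < \<bar>M\<bar> + 1" "0 < K * (K * R) + 1"
    using K_pos R by (auto intro!: add_nonneg_pos)
  have "0 < d"
    unfolding d_def using \<rho>(1) \<delta>(1) h0 \<epsilon> pos by (subst Min_gr_iff) auto
  moreover have "d \<le> \<rho>" "d \<le> \<delta>" "d \<le> h0" "d \<le> \<epsilon> / 4 / (\<bar>M\<bar> + 1)" "d \<le> \<epsilon> / 4 / (K * (K * R) + 1)"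
    unfolding d_def by (intro Min_le; blast)+
  ultimately have d: "0 < d" "d \<le> \<rho>" "d \<le> \<delta>" "d \<le> h0"
    "d \<le> \<epsilon> / 4 / (\<bar>M\<bar> + 1)" "d \<le> \<epsilon> / 4 / (K * (K * R) + 1)" .
  have "tracks \<alpha> R a e b (e * exp ((K + 1) * (b - a)))"
    if ab: "a \<le> x" "x \<le> b" "b - a < d" and e: "\<epsilon> \<le> e" "e \<le> 1" for a b e
  proof -
    define h where "h = b - a"
    have h: "0 \<le> h" "h \<le> d" using ab by (auto simp: h_def)
    have hM: "M * h \<le> \<epsilon> / 4"
      by (rule mult_le_of_le_divide[where C = "\<bar>M\<bar>"]) (use h d in auto)
    have hK: "K * (K * R) * h \<le> \<epsilon> / 4"
      by (rule mult_le_of_le_divide[where C = "K * (K * R)"]) (use h d K_pos R in auto)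
    have range: "0 \<le> a" "b \<le> \<tau>"
      using ab d \<rho> s_range[of i] s_range[of "Suc i"] i by auto
    obtain \<Phi> where \<Phi>: "net_approximable \<alpha> \<Phi>" "\<And>z. norm (\<Phi> z - (z + h *\<^sub>R g z)) \<le> M * h\<^sup>2"
      using M[of h] h d by auto
    have "norm (\<Phi> z - Y b) \<le> e * exp ((K + 1) * (b - a))"
      if Y: "Y \<in> solutions_within R" and z: "norm (z - Y a) \<le> e" for Y z
    proof -
      obtain y0 where y0: "ode_solution w \<tau> y0 Y" using Y by (auto simp: solutions_within_def)
      have YR: "norm (Y r) \<le> R" if "r \<in> {0..\<tau>}" for r
        using Y that by (auto simp: solutions_within_def)
      have zR: "norm z \<le> R + 1"
        using norm_triangle_ineq[of "z - Y a" "Y a"] YR[of a] z e range ab by simp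
      \<comment> \<open>The Euler increment h g(z) is compared with the exact one under the
        integral. Replacing \<open>w\<close> by \<open>g\<close>, freezing time and letting
        \<open>Y\<close> drift cost \<epsilon>/4 each; the initial error contributes K e. The
        remaining quarter is left for \<Phi>.\<close>
      have "((\<lambda>r. w (Y r) r - g z) has_integral (Y b - Y a - measure lborel (cbox a b) *\<^sub>R g z)) (cbox a b)"
        using solution_has_integral[OF y0 range(1) _ range(2)] ab
        by (intro has_integral_diff has_integral_const) simp
      then have "norm (Y b - Y a - measure lborel (cbox a b) *\<^sub>R g z) \<le> (K * e + 3 * \<epsilon> / 4) * measure lborel (cbox a b)"
      proof (rule has_integral_bound[rotated])
        fix r assume r: "r \<in> cbox a b"
        have "norm (z - Y r) \<le> norm (z - Y a) + norm (Y r - Y a)"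
          using norm_triangle_ineq4[of "z - Y a" "Y r - Y a"] by simp
        also have "norm (Y r - Y a) \<le> K * R * (r - a)"
          using r range by (intro solutions_within_speed Y R) auto
        also have "\<dots> \<le> K * R * h"
          using r K_pos R by (intro mult_left_mono) (auto simp: h_def)
        finally have "K * norm (z - Y r) \<le> K * (e + K * R * h)"
          using z K_pos by (intro mult_left_mono) auto
        then have 1: "norm (w z r - w (Y r) r) \<le> K * e + \<epsilon> / 4"
          using lipschitz[of z r "Y r"] hK by (simp add: algebra_simps)
        have 2: "norm (w z x - w z r) \<le> \<epsilon> / 4"
          using r ab d by (intro time zR) auto
        have "w (Y r) r - g z = - ((g z - w z x) + (w z x - w z r) + (w z r - w (Y r) r))"
          by simp
        also have "norm \<dots> \<le> \<epsilon> / 4 + \<epsilon> / 4 + (K * e + \<epsilon> / 4)"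
          unfolding norm_minus_cancel by (intro norm_triangle_mono g(2) zR 1 2)
        finally show "norm (w (Y r) r - g z) \<le> K * e + 3 * \<epsilon> / 4" by simp
      qed (use K_pos e \<epsilon> in simp)
      then have 1: "norm (Y b - Y a - h *\<^sub>R g z) \<le> (K * e + 3 * \<epsilon> / 4) * h"
        using ab by (simp add: h_def)
      have "\<Phi> z - Y b = (\<Phi> z - (z + h *\<^sub>R g z)) + (z - Y a) - (Y b - Y a - h *\<^sub>R g z)"
        by simp
      also have "norm \<dots> \<le> M * h\<^sup>2 + e + (K * e + 3 * \<epsilon> / 4) * h"
        by (intro order_trans[OF norm_triangle_ineq4] add_mono norm_triangle_mono \<Phi>(2) z 1)
      also have "\<dots> \<le> \<epsilon> / 4 * h + e + (K * e + 3 * \<epsilon> / 4) * h"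
        using mult_right_mono[OF hM h(1)] by (simp add: power2_eq_square mult.assoc)
      also have "\<dots> = e + (K * e + \<epsilon>) * h" by (simp add: algebra_simps)
      also have "\<dots> \<le> e + (K * e + e) * h" using e h by (intro add_left_mono mult_right_mono) auto
      also have "\<dots> = e * (1 + (K + 1) * h)" by (simp add: algebra_simps)
      also have "\<dots> \<le> e * exp ((K + 1) * h)"
        using e \<epsilon> by (intro mult_left_mono exp_ge_add_one_self) auto
      finally show ?thesis by (simp add: h_def)
    qed
    then show ?thesis using \<Phi>(1) unfolding tracks_def by blast
  qed
  then show ?thesis using d(1) by blast
qed

lemma tracks_interior:
  assumes \<alpha>: "0 < \<alpha>" "\<alpha> < 1" and R: "0 \<le> R" and i: "i < m"
    and pq: "s i < p" "p \<le> q" "q < s (Suc i)" and e: "0 < e" "e * exp ((K + 1) * (q - p)) \<le> 1"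
  shows "tracks \<alpha> R p e q (e * exp ((K + 1) * (q - p)))"
proof -
  define \<eta> where "\<eta> t = e * exp ((K + 1) * (t - p))" for t
  have \<eta>_mono: "\<eta> a \<le> \<eta> b" if "a \<le> b" for a b
    using that e(1) K_pos by (simp add: \<eta>_def)
  have \<eta>p: "\<eta> p = e" by (simp add: \<eta>_def)
  \<comment> \<open>The guards are needed because the small intervals offered by the bisection
    argument contain a point between \<open>p\<close> and \<open>q\<close> but may stick
    out.\<close>
  define P where "P a b \<longleftrightarrow> (p \<le> a \<longrightarrow> b \<le> q \<longrightarrow> tracks \<alpha> R a (\<eta> a) b (\<eta> b))" for a b
  have "P p q"
    using pq(2)
  proof (induction rule: Bolzano)
    case (trans a b c)
    then show ?case by (auto simp: P_def intro: tracks_trans)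
  next
    case (local x)
    have "\<exists>d>0. \<forall>a b e'. a \<le> x \<and> x \<le> b \<and> b - a < d \<and> e \<le> e' \<and> e' \<le> 1 \<longrightarrow>
        tracks \<alpha> R a e' b (e' * exp ((K + 1) * (b - a)))"
      using local pq e by (intro tracks_local[OF \<alpha> R i]) auto
    then obtain d where d: "d > 0" "\<And>a b e'. a \<le> x \<Longrightarrow> x \<le> b \<Longrightarrow> b - a < d \<Longrightarrow> e \<le> e' \<Longrightarrow> e' \<le> 1 \<Longrightarrow>
        tracks \<alpha> R a e' b (e' * exp ((K + 1) * (b - a)))"
      by blast
    have "P a b" if ab: "a \<le> x" "x \<le> b" "b - a < d" for a b
      unfolding P_def
    proof (intro impI)
      assume *: "p \<le> a" "b \<le> q"
      have "\<eta> a * exp ((K + 1) * (b - a)) = \<eta> b"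
        by (simp add: \<eta>_def mult.assoc exp_add[symmetric] algebra_simps)
      moreover have "\<eta> a \<le> 1"
        using \<eta>_mono[of a q] * ab e(2) by (simp add: \<eta>_def)
      ultimately show "tracks \<alpha> R a (\<eta> a) b (\<eta> b)"
        using d(2)[OF ab, of "\<eta> a"] \<eta>_mono[of p a] * \<eta>p by simp
    qed
    then show ?case using d(1) by blast
  qed
  then show ?thesis by (simp add: P_def \<eta>p) (simp add: \<eta>_def)
qed

lemma tracks_piece:
  assumes \<alpha>: "0 < \<alpha>" "\<alpha> < 1" and R: "0 \<le> R" and i: "i < m" and f: "0 < f"
  shows "\<exists>e>0. tracks \<alpha> R (s i) e (s (Suc i)) f"
proof -
  define E where "E = exp ((K + 1) * \<tau>)"
  have E: "1 \<le> E" using K_pos tau_nonneg by (simp add: E_def)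
  \<comment> \<open>Waiting after \<open>s i\<close> raises the tolerance from e to 2 e, the
    interior multiplies it by at most E, and waiting before the next breakpoint adds e \<le> e E.
    The total 3 e E is below \<open>f\<close>, and 2 e E \<le> 1 as the interior step
    demands.\<close>
  define e where "e = min 1 f / (4 * E)"
  have e: "0 < e" "4 * (e * E) = min 1 f" using E f by (auto simp: e_def)
  have eE: "e \<le> e * E" using mult_left_mono[OF E, of e] e by simp
  define \<eta> where "\<eta> = min ((s (Suc i) - s i) / 3) (e / (K * R + 1))"
  have pos: "0 < K * R + 1" using K_pos R by (auto intro!: add_nonneg_pos)
  have "\<eta> \<le> (s (Suc i) - s i) / 3"
    unfolding \<eta>_def by (rule min.cobounded1)
  moreover have "0 < \<eta>" "\<eta> \<le> e / (K * R + 1)"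
    using s_Suc[OF i] e(1) pos by (auto simp: \<eta>_def)
  ultimately have \<eta>: "0 < \<eta>" "3 * \<eta> \<le> s (Suc i) - s i" "\<eta> \<le> e / (K * R + 1)"
    by simp_all
  have KR: "K * R * \<eta> \<le> e"
    by (rule mult_le_of_le_divide[where C = "K * R"]) (use \<eta> K_pos R in auto)
  define p q where "p = s i + \<eta>" and "q = s (Suc i) - \<eta>"
  have pq: "s i < p" "p \<le> q" "q < s (Suc i)" using \<eta> by (auto simp: p_def q_def)
  have range: "0 \<le> s i" "s (Suc i) \<le> \<tau>" using s_range[of i] s_range[of "Suc i"] i by auto
  have "exp ((K + 1) * (q - p)) \<le> E"
    unfolding E_def using K_pos pq range by (auto intro!: mult_left_mono)
  then have le: "2 * e * exp ((K + 1) * (q - p)) \<le> 2 * e * E"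
    using e by (intro mult_left_mono) auto
  have le_1: "2 * e * exp ((K + 1) * (q - p)) \<le> 1" and le_f: "2 * e * E + K * R * \<eta> \<le> f"
    using le e KR eE by linarith+
  have "tracks \<alpha> R (s i) e p (2 * e)"
    by (rule tracks_mono[OF tracks_wait[of "s i" p R \<alpha> e]])
      (use pq range R KR in \<open>auto simp: p_def\<close>)
  moreover have "tracks \<alpha> R p (2 * e) q (2 * e * exp ((K + 1) * (q - p)))"
    by (rule tracks_interior[OF \<alpha> R i pq]) (use le_1 e in auto)
  moreover have "tracks \<alpha> R q (2 * e * exp ((K + 1) * (q - p))) (s (Suc i)) f"
    by (rule tracks_mono[OF tracks_wait[of q "s (Suc i)" R \<alpha> "2 * e * E"]])
      (use pq range R le le_f in \<open>auto simp: q_def\<close>)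
  ultimately show ?thesis using e(1) tracks_trans by blast
qed

text \<open>Tolerances are fixed backwards in time: the last piece determines the accuracy required
  at its start, which the induction hypothesis, general in \<open>f\<close>, then delivers.\<close>

lemma tracks_all:
  assumes \<alpha>: "0 < \<alpha>" "\<alpha> < 1" and R: "0 \<le> R" and f: "0 < f"
  shows "\<exists>e>0. tracks \<alpha> R 0 e \<tau> f"
proof -
  have "i \<le> m \<Longrightarrow> \<exists>e>0. tracks \<alpha> R 0 e (s i) f" if "0 < f" for i f
    using that
  proof (induction i arbitrary: f)
    case 0
    have "tracks \<alpha> R 0 f 0 (f + K * R * (0 - 0))"
      using tau_nonneg R by (intro tracks_wait) auto
    then show ?case using 0 by (auto simp: s_0)
  next
    case (Suc i)
    obtain e' where e': "e' > 0" "tracks \<alpha> R (s i) e' (s (Suc i)) f"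
      using tracks_piece[OF \<alpha> R, of i f] Suc.prems by auto
    obtain e where "e > 0" "tracks \<alpha> R 0 e (s i) e'"
      using Suc.IH[OF _ e'(1)] Suc.prems by auto
    then show ?case using tracks_trans[OF _ e'(2)] by blast
  qed
  from this[of f m] show ?thesis using f by (simp add: s_m)
qed

lemma flow_net_approximable:
  assumes \<alpha>: "0 < \<alpha>" "\<alpha> < 1" and f: "0 < f"
  shows "\<exists>F. net_approximable \<alpha> F \<and>
    (\<forall>y Y. norm y \<le> B \<longrightarrow> ode_solution w \<tau> y Y \<longrightarrow> norm (F y - Y \<tau>) \<le> f)"
proof -
  \<comment> \<open>The Gronwall bound against the zero solution, valid for all solutions starting
    in the ball of radius \<open>B\<close>.\<close>
  define R where "R = 2 * \<bar>B\<bar> * exp (2 * K * \<tau>)"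
  obtain e F where e: "0 < e" and F: "net_approximable \<alpha> F"
    "\<And>Y z. Y \<in> solutions_within R \<Longrightarrow> norm (z - Y 0) \<le> e \<Longrightarrow> norm (F z - Y \<tau>) \<le> f"
    using tracks_all[OF \<alpha>, of R f] f unfolding tracks_def by (auto simp: R_def)
  have "norm (F y - Y \<tau>) \<le> f" if y: "norm y \<le> B" and Y: "ode_solution w \<tau> y Y" for y Y
  proof (rule F(2))
    have "norm (Y t) \<le> R" if "t \<in> {0..\<tau>}" for t
    proof -
      have "2 * norm y * exp (2 * K * \<tau>) \<le> R"
        unfolding R_def using y by (intro mult_right_mono) auto
      then show ?thesis using norm_solution_le[OF Y that] by linarith
    qed
    then show "Y \<in> solutions_within R" using Y by (auto simp: solutions_within_def)
    show "norm (y - Y 0) \<le> e" using Y e by (simp add: ode_solution_def)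
  qed
  then show ?thesis using F(1) by blast
qed

end

subsection \<open>Reduction of the flow map to a centred field\<close>

text \<open>The value 0 outside the open interval makes the Lipschitz bound hold at all times;
  inside the time interval only the two endpoints are affected, which integrals ignore.\<close>

definition centred_at ::
    "(real \<Rightarrow> real ^ 'n) \<Rightarrow> real \<Rightarrow> (real ^ 'n \<Rightarrow> real \<Rightarrow> real ^ 'n) \<Rightarrow> real ^ 'n \<Rightarrow> real \<Rightarrow> real ^ 'n" where
  "centred_at Z \<tau> v y t = (if t \<in> {0<..<\<tau>} then v (Z t + y) t - v (Z t) t else 0)"

lemma centred_field_centred_at:
  assumes v: "standing_assumption v \<tau>" and Z: "continuous_on {0..\<tau>} Z"
  obtains K m s where "centred_field (centred_at Z \<tau> v) \<tau> K m s"
proof -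
  obtain K m s where K: "\<And>t. t \<in> {0<..<\<tau>} \<Longrightarrow> K-lipschitz_on UNIV (\<lambda>x. v x t)"
    and s: "s 0 = 0" "s m = \<tau>" "\<And>i. i < m \<Longrightarrow> s i < s (Suc i)"
    and cont: "\<And>i. i < m \<Longrightarrow> continuous_on (UNIV \<times> {s i<..<s (Suc i)}) (\<lambda>(x, t). v x t)"
    using v unfolding standing_assumption_def by blast
  have mono: "i \<le> j \<Longrightarrow> j \<le> m \<Longrightarrow> s i \<le> s j" for i j
  proof (induction j)
    case (Suc j)
    then show ?case using s(3)[of j] by (cases "i = Suc j") auto
  qed simp
  have "centred_field (centred_at Z \<tau> v) \<tau> (\<bar>K\<bar> + 1) m s"
  proof
    show "norm (centred_at Z \<tau> v x t - centred_at Z \<tau> v y t) \<le> (\<bar>K\<bar> + 1) * norm (x - y)" for x y t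
    proof (cases "t \<in> {0<..<\<tau>}")
      case True
      have "dist (v (Z t + x) t) (v (Z t + y) t) \<le> K * dist (Z t + x) (Z t + y)"
        using K[OF True] by (rule lipschitz_onD) auto
      also have "\<dots> \<le> (\<bar>K\<bar> + 1) * norm (x - y)"
        by (simp add: dist_norm mult_right_mono)
      finally show ?thesis using True by (simp add: centred_at_def dist_norm)
    qed (auto simp: centred_at_def)
    fix i assume i: "i < m"
    have sub: "{s i<..<s (Suc i)} \<subseteq> {0<..<\<tau>}"
      using mono[of 0 i] mono[of "Suc i" m] i s by auto
    have Z': "continuous_on (UNIV \<times> {s i<..<s (Suc i)}) (\<lambda>p. Z (snd p))"
      by (rule continuous_on_compose2[OF Z]) (use sub in \<open>auto intro!: continuous_intros\<close>)
    have "continuous_on (UNIV \<times> {s i<..<s (Suc i)})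
        (\<lambda>p. (\<lambda>(x, t). v x t) (Z (snd p) + fst p, snd p) - (\<lambda>(x, t). v x t) (Z (snd p), snd p))"
      by (intro continuous_on_diff continuous_on_compose2[OF cont[OF i]] continuous_intros Z') auto
    then show "continuous_on (UNIV \<times> {s i<..<s (Suc i)}) (\<lambda>(x, t). centred_at Z \<tau> v x t)"
      by (rule continuous_on_eq) (use sub in \<open>auto simp: centred_at_def\<close>)
  qed (use s in \<open>auto simp: centred_at_def\<close>)
  then show ?thesis by (rule that)
qed

text \<open>The integral of \<open>v\<close> along \<open>Z\<close> exists because \<open>Z\<close>
  is a solution, so it can be subtracted and added back by linearity, without absolute
  integrability.\<close>

lemma ode_solution_centred_at_iff:
  assumes Z: "ode_solution v \<tau> z0 Z"
  shows "ode_solution (centred_at Z \<tau> v) \<tau> (x0 - z0) (\<lambda>t. X t - Z t) \<longleftrightarrow> ode_solution v \<tau> x0 X"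
proof
  have cZ: "continuous_on {0..\<tau>} Z" "Z 0 = z0"
    and iZ: "\<And>t. t \<in> {0..\<tau>} \<Longrightarrow> ((\<lambda>r. v (Z r) r) has_integral (Z t - z0)) {0..t}"
    using Z by (auto simp: ode_solution_def)
  {
    assume X: "ode_solution v \<tau> x0 X"
    have "((\<lambda>r. centred_at Z \<tau> v (X r - Z r) r) has_integral (X t - Z t - (x0 - z0))) {0..t}"
      if t: "t \<in> {0..\<tau>}" for t
    proof (rule has_integral_spike_finite)
      have "((\<lambda>r. v (X r) r - v (Z r) r) has_integral ((X t - x0) - (Z t - z0))) {0..t}"
        using X t iZ by (intro has_integral_diff) (auto simp: ode_solution_def)
      then show "((\<lambda>r. v (X r) r - v (Z r) r) has_integral (X t - Z t - (x0 - z0))) {0..t}"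
        by (simp add: algebra_simps)
      show "finite {0, \<tau>}" by simp
    qed (use t in \<open>auto simp: centred_at_def\<close>)
    then show "ode_solution (centred_at Z \<tau> v) \<tau> (x0 - z0) (\<lambda>t. X t - Z t)"
      using X cZ by (auto simp: ode_solution_def intro!: continuous_intros)
  next
    assume Y: "ode_solution (centred_at Z \<tau> v) \<tau> (x0 - z0) (\<lambda>t. X t - Z t)"
    have "continuous_on {0..\<tau>} (\<lambda>t. (X t - Z t) + Z t)"
      using Y cZ by (intro continuous_on_add) (auto simp: ode_solution_def)
    moreover have "((\<lambda>r. v (X r) r) has_integral (X t - x0)) {0..t}" if t: "t \<in> {0..\<tau>}" for t
    proof (rule has_integral_spike_finite)
      have "((\<lambda>r. centred_at Z \<tau> v (X r - Z r) r + v (Z r) r)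
          has_integral ((X t - Z t - (x0 - z0)) + (Z t - z0))) {0..t}"
        using Y t iZ by (intro has_integral_add) (auto simp: ode_solution_def)
      then show "((\<lambda>r. centred_at Z \<tau> v (X r - Z r) r + v (Z r) r) has_integral (X t - x0)) {0..t}"
        by simp
      show "finite {0, \<tau>}" by simp
    qed (use t in \<open>auto simp: centred_at_def\<close>)
    moreover have "X 0 = x0" using Y cZ by (simp add: ode_solution_def)
    ultimately show "ode_solution v \<tau> x0 X"
      by (simp add: ode_solution_def)
  }
qed

theorem mainTheorem1:
  fixes \<alpha> \<tau> \<epsilon> :: real
    and v :: "real ^ 'n \<Rightarrow> real \<Rightarrow> real ^ 'n"
    and \<Omega> :: "(real ^ 'n) set"
  assumes "0 < \<alpha>" and "\<alpha> < 1"
    and "0 < \<tau>"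
    and "standing_assumption v \<tau>"
    and "compact \<Omega>"
    and "0 < \<epsilon>"
  shows "\<exists>L::nat. \<exists>f \<in> leaky_nets \<alpha> L. \<forall>x\<in>\<Omega>. norm (f x - flow_map v \<tau> x) \<le> \<epsilon>"
proof (cases "\<exists>z0 Z. ode_solution v \<tau> z0 Z")
  case False
  \<comment> \<open>\<open>v\<close> may be non-integrable at a breakpoint; then \<open>flow_map\<close> is the junk value \<open>THE y. False\<close>
    for every initial point, hence constant.\<close>
  then have "flow_map v \<tau> x = (THE y. False)" for x
    by (simp add: flow_map_def)
  moreover have "(\<lambda>x. 0 *v x + (THE y. False)) \<in> leaky_nets \<alpha> 0"
    by (rule affine_in_leaky_nets)
  ultimately show ?thesis
    using assms(6) by (intro exI bexI[of _ "\<lambda>x. 0 *v x + (THE y. False)"]) simp_all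
next
  case True
  then obtain z0 Z where Z: "ode_solution v \<tau> z0 Z" by blast
  then have "continuous_on {0..\<tau>} Z" by (simp add: ode_solution_def)
  then obtain K m s where "centred_field (centred_at Z \<tau> v) \<tau> K m s"
    using centred_field_centred_at[OF assms(4)] by blast
  then interpret centred_field "centred_at Z \<tau> v" \<tau> K m s .
  \<comment> \<open>The one solution \<open>Z\<close> yields existence and uniqueness from every
    initial point, so the definite description in \<open>flow_map\<close> denotes the endpoint of
    the solution.\<close>
  have flow: "\<exists>Y. ode_solution (centred_at Z \<tau> v) \<tau> (x - z0) Y \<and> flow_map v \<tau> x = Y \<tau> + Z \<tau>" for x
  proof -
    obtain Y where Y: "ode_solution (centred_at Z \<tau> v) \<tau> (x - z0) Y"
      using solution_exists by blast
    have "flow_map v \<tau> x = Y \<tau> + Z \<tau>"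
      unfolding flow_map_def
    proof (rule the_equality)
      have "ode_solution v \<tau> x (\<lambda>t. Y t + Z t)"
        using ode_solution_centred_at_iff[OF Z, of x "\<lambda>t. Y t + Z t"] Y by simp
      then show "\<exists>X. ode_solution v \<tau> x X \<and> X \<tau> = Y \<tau> + Z \<tau>" by blast
      fix y assume "\<exists>X. ode_solution v \<tau> x X \<and> X \<tau> = y"
      then obtain X where "ode_solution v \<tau> x X" "X \<tau> = y" by blast
      then show "y = Y \<tau> + Z \<tau>"
        using solution_unique[OF _ Y, of "\<lambda>t. X t - Z t" \<tau>] assms(3)
          ode_solution_centred_at_iff[OF Z, of x X] by (simp add: algebra_simps)
    qed
    then show ?thesis using Y by blast
  qed
  obtain B where B: "\<And>x. x \<in> \<Omega> \<Longrightarrow> norm x \<le> B"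
    using compact_imp_bounded[OF assms(5)] unfolding bounded_iff by blast
  \<comment> \<open>The centred problem starts at x - z0, hence the enlarged radius; the two
    translations are attached to \<open>F\<close> below.\<close>
  obtain F where F: "net_approximable \<alpha> F"
    "\<And>y Y. norm y \<le> B + norm z0 \<Longrightarrow> ode_solution (centred_at Z \<tau> v) \<tau> y Y \<Longrightarrow> norm (F y - Y \<tau>) \<le> \<epsilon> / 2"
    using flow_net_approximable[OF assms(1,2), of "\<epsilon> / 2" "B + norm z0"] assms(6) by auto
  have "net_approximable \<alpha> ((\<lambda>x. x + Z \<tau>) \<circ> (F \<circ> (\<lambda>x. x + - z0)))"
    by (intro net_approximable_comp F(1) net_approximable_translation)
  then obtain L f where f: "f \<in> leaky_nets \<alpha> L"
    "\<And>x. norm x \<le> B \<Longrightarrow> norm (f x - (F (x - z0) + Z \<tau>)) \<le> \<epsilon> / 2"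
    using half_gt_zero[OF assms(6)] unfolding net_approximable_def o_def add_uminus_conv_diff by meson
  have "norm (f x - flow_map v \<tau> x) \<le> \<epsilon>" if x: "x \<in> \<Omega>" for x
  proof -
    obtain Y where Y: "ode_solution (centred_at Z \<tau> v) \<tau> (x - z0) Y" "flow_map v \<tau> x = Y \<tau> + Z \<tau>"
      using flow by blast
    have "norm (x - z0) \<le> B + norm z0"
      using norm_triangle_ineq4[of x z0] B[OF x] by simp
    then show ?thesis
      using norm_triangle_le[of "f x - (F (x - z0) + Z \<tau>)" "F (x - z0) - Y \<tau>" \<epsilon>]
        f(2)[OF B[OF x]] F(2)[OF _ Y(1)] Y(2) by (simp add: algebra_simps)
  qed
  then show ?thesis using f(1) by blast
qed

end
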